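(* Consider the state-dependent Z-interference channel $p(y_1|x_1,s)\,p(y_2|x_1,x_2,s)$ with discrete memoryless state $p(s)$, where the state sequence is known noncausally at encoder 1 only. A rate pair $(R_1,R_2)$ is achievable if $$\begin{aligned} R_1 & < I(U;Y_1|Q)-I(U;S|Q),\\ R_2 & < I(X_2;Y_2|V,Q),\\ R_2 & < I(V,X_2;Y_2|Q) - I(V;S|Q),\\ R_1 + R_2 & < I(U;Y_1|Q)+ I(V,X_2;Y_2|Q) -I(U;S|Q)- I(U,S;V|Q), \end{aligned}$$ for some pmf $p(q)\,p(u,v|s,q)\,p(x_1|u,v,s,q)\,p(x_2|q)$ (with $Q,U,V$ taking values in finite alphabets), where the information quantities are evaluated under the joint pmf $p(s)\,p(q)\,p(u,v|s,q)\,p(x_1|u,v,s,q)\,p(x_2|q)\,p(y_1|x_1,s)\,p(y_2|x_1,x_2,s)$.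
   Context: All alphabets $\mathcal{S},\mathcal{X}_1,\mathcal{X}_2,\mathcal{Y}_1,\mathcal{Y}_2$ are finite. The state sequence $S^n$ is i.i.d. according to $p(s)$ and independent of the messages; the channel is memoryless given the states and inputs. $[1:2^{nR}]$ denotes the set $\{1,\dots,\lceil 2^{nR}\rceil\}$. The messages $M_1,M_2$ are independent, uniform on $[1:2^{nR_1}]$ and $[1:2^{nR_2}]$; sender $j$ communicates $M_j$ to receiver $j$. An $(n,2^{nR_1},2^{nR_2},\epsilon)$ code consists of encoding functions $f_{1,i}:[1:2^{nR_1}]\times\mathcal{S}^n\to\mathcal{X}_1$ and $f_{2,i}:[1:2^{nR_2}]\to\mathcal{X}_2$, $1\le i\le n$, and decoding functions $g_j:\mathcal{Y}_j^n\to[1:2^{nR_j}]$, $j\in\{1,2\}$, with $\Pr\{g_j(Y_j^n)\ne M_j\}\le\epsilon$ for $j\in\{1,2\}$. A rate pair $(R_1,R_2)$ (of nonnegative reals) is achievable if for every $\epsilon>0$ there exists an $(n,2^{nR_1},2^{nR_2},\epsilon)$ code for all sufficiently large $n$. *)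

theory Defs
  imports "HOL-Probability.Probability"
begin

(* Length-n sequences are functions on {1..n} that are undefined outside {1..n}; these are exactly
   the possible values of a draw from Pi_pmf {1..n} undefined p, which has independent components
   distributed according to p 1, ..., p n.  Hence an encoder or decoder applied to such a draw
   depends on nothing but the n letters of the sequence. *)

definition messages :: "nat \<Rightarrow> real \<Rightarrow> nat set" where
  "messages n R = {1..nat \<lceil>2 powr (real n * R)\<rceil>}"

(* f1 i m1 s and f2 i m2 are the i-th channel inputs of the two senders; the whole state sequence s
   is available to encoder 1 at every time i, and encoder 2 does not see it. *)
definition transmission_pmf ::
  "'s pmf \<Rightarrow> ('x1 \<Rightarrow> 's \<Rightarrow> 'y1 pmf) \<Rightarrow> ('x1 \<Rightarrow> 'x2 \<Rightarrow> 's \<Rightarrow> 'y2 pmf) \<Rightarrow>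
   nat \<Rightarrow> real \<Rightarrow> real \<Rightarrow>
   (nat \<Rightarrow> nat \<Rightarrow> (nat \<Rightarrow> 's) \<Rightarrow> 'x1) \<Rightarrow> (nat \<Rightarrow> nat \<Rightarrow> 'x2) \<Rightarrow>
   (nat \<times> nat \<times> (nat \<Rightarrow> 'y1) \<times> (nat \<Rightarrow> 'y2)) pmf" where
  "transmission_pmf pS W1 W2 n R1 R2 f1 f2 = do {
     m1 \<leftarrow> pmf_of_set (messages n R1);
     m2 \<leftarrow> pmf_of_set (messages n R2);
     s \<leftarrow> Pi_pmf {1..n} undefined (\<lambda>_. pS);
     y1 \<leftarrow> Pi_pmf {1..n} undefined (\<lambda>i. W1 (f1 i m1 s) (s i));
     y2 \<leftarrow> Pi_pmf {1..n} undefined (\<lambda>i. W2 (f1 i m1 s) (f2 i m2) (s i));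
     return_pmf (m1, m2, y1, y2)
   }"

definition is_code ::
  "'s pmf \<Rightarrow> ('x1 \<Rightarrow> 's \<Rightarrow> 'y1 pmf) \<Rightarrow> ('x1 \<Rightarrow> 'x2 \<Rightarrow> 's \<Rightarrow> 'y2 pmf) \<Rightarrow>
   nat \<Rightarrow> real \<Rightarrow> real \<Rightarrow> real \<Rightarrow>
   (nat \<Rightarrow> nat \<Rightarrow> (nat \<Rightarrow> 's) \<Rightarrow> 'x1) \<Rightarrow> (nat \<Rightarrow> nat \<Rightarrow> 'x2) \<Rightarrow>
   ((nat \<Rightarrow> 'y1) \<Rightarrow> nat) \<Rightarrow> ((nat \<Rightarrow> 'y2) \<Rightarrow> nat) \<Rightarrow> bool" where
  "is_code pS W1 W2 n R1 R2 \<epsilon> f1 f2 g1 g2 \<longleftrightarrow>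
     g1 \<in> ({1..n} \<rightarrow>\<^sub>E UNIV) \<rightarrow> messages n R1 \<and>
     g2 \<in> ({1..n} \<rightarrow>\<^sub>E UNIV) \<rightarrow> messages n R2 \<and>
     measure_pmf.prob (transmission_pmf pS W1 W2 n R1 R2 f1 f2)
       {(m1, m2, y1, y2). g1 y1 \<noteq> m1} \<le> \<epsilon> \<and>
     measure_pmf.prob (transmission_pmf pS W1 W2 n R1 R2 f1 f2)
       {(m1, m2, y1, y2). g2 y2 \<noteq> m2} \<le> \<epsilon>"

definition achievable ::
  "'s pmf \<Rightarrow> ('x1 \<Rightarrow> 's \<Rightarrow> 'y1 pmf) \<Rightarrow> ('x1 \<Rightarrow> 'x2 \<Rightarrow> 's \<Rightarrow> 'y2 pmf) \<Rightarrow>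
   real \<Rightarrow> real \<Rightarrow> bool" where
  "achievable pS W1 W2 R1 R2 \<longleftrightarrow>
     (\<forall>\<epsilon>>0. \<forall>\<^sub>F n in sequentially. \<exists>f1 f2 g1 g2. is_code pS W1 W2 n R1 R2 \<epsilon> f1 f2 g1 g2)"

definition single_letter_pmf ::
  "'s pmf \<Rightarrow> ('x1 \<Rightarrow> 's \<Rightarrow> 'y1 pmf) \<Rightarrow> ('x1 \<Rightarrow> 'x2 \<Rightarrow> 's \<Rightarrow> 'y2 pmf) \<Rightarrow>
   'q pmf \<Rightarrow> ('s \<Rightarrow> 'q \<Rightarrow> ('u \<times> 'v) pmf) \<Rightarrow> ('u \<Rightarrow> 'v \<Rightarrow> 's \<Rightarrow> 'q \<Rightarrow> 'x1 pmf) \<Rightarrow> ('q \<Rightarrow> 'x2 pmf) \<Rightarrow>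
   ('s \<times> 'q \<times> 'u \<times> 'v \<times> 'x1 \<times> 'x2 \<times> 'y1 \<times> 'y2) pmf" where
  "single_letter_pmf pS W1 W2 pQ pUV pX1 pX2 = do {
     s \<leftarrow> pS;
     q \<leftarrow> pQ;
     (u, v) \<leftarrow> pUV s q;
     x1 \<leftarrow> pX1 u v s q;
     x2 \<leftarrow> pX2 q;
     y1 \<leftarrow> W1 x1 s;
     y2 \<leftarrow> W2 x1 x2 s;
     return_pmf (s, q, u, v, x1, x2, y1, y2)
   }"

fun rvS :: "'s \<times> 'q \<times> 'u \<times> 'v \<times> 'x1 \<times> 'x2 \<times> 'y1 \<times> 'y2 \<Rightarrow> 's" where
  "rvS (s, q, u, v, x1, x2, y1, y2) = s"
fun rvQ :: "'s \<times> 'q \<times> 'u \<times> 'v \<times> 'x1 \<times> 'x2 \<times> 'y1 \<times> 'y2 \<Rightarrow> 'q" where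
  "rvQ (s, q, u, v, x1, x2, y1, y2) = q"
fun rvU :: "'s \<times> 'q \<times> 'u \<times> 'v \<times> 'x1 \<times> 'x2 \<times> 'y1 \<times> 'y2 \<Rightarrow> 'u" where
  "rvU (s, q, u, v, x1, x2, y1, y2) = u"
fun rvV :: "'s \<times> 'q \<times> 'u \<times> 'v \<times> 'x1 \<times> 'x2 \<times> 'y1 \<times> 'y2 \<Rightarrow> 'v" where
  "rvV (s, q, u, v, x1, x2, y1, y2) = v"
fun rvX2 :: "'s \<times> 'q \<times> 'u \<times> 'v \<times> 'x1 \<times> 'x2 \<times> 'y1 \<times> 'y2 \<Rightarrow> 'x2" where
  "rvX2 (s, q, u, v, x1, x2, y1, y2) = x2"
fun rvY1 :: "'s \<times> 'q \<times> 'u \<times> 'v \<times> 'x1 \<times> 'x2 \<times> 'y1 \<times> 'y2 \<Rightarrow> 'y1" where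
  "rvY1 (s, q, u, v, x1, x2, y1, y2) = y1"
fun rvY2 :: "'s \<times> 'q \<times> 'u \<times> 'v \<times> 'x1 \<times> 'x2 \<times> 'y1 \<times> 'y2 \<Rightarrow> 'y2" where
  "rvY2 (s, q, u, v, x1, x2, y1, y2) = y2"

definition pair_rv :: "('w \<Rightarrow> 'a) \<Rightarrow> ('w \<Rightarrow> 'b) \<Rightarrow> 'w \<Rightarrow> 'a \<times> 'b" (infixr "\<^bold>," 65) where
  "(X \<^bold>, Y) = (\<lambda>\<omega>. (X \<omega>, Y \<omega>))"

(* In bits.  This is conditional_mutual_information_Pow of the locale
   information_space (measure_pmf p) 2, written outside the locale. *)
definition cond_mi :: "'w pmf \<Rightarrow> ('w \<Rightarrow> 'a) \<Rightarrow> ('w \<Rightarrow> 'b) \<Rightarrow> ('w \<Rightarrow> 'c) \<Rightarrow> real"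
    (\<open>\<I>\<^bsub>_\<^esub>'(_ ; _ | _')\<close>) where
  "\<I>\<^bsub>p\<^esub>(X ; Y | Z) = prob_space.conditional_mutual_information (measure_pmf p) 2
     (count_space (X ` space (measure_pmf p))) (count_space (Y ` space (measure_pmf p)))
     (count_space (Z ` space (measure_pmf p))) X Y Z"

lemma cond_mi_eq_sum:
  fixes X :: "'w \<Rightarrow> 'a::finite" and Y :: "'w \<Rightarrow> 'b::finite" and Z :: "'w \<Rightarrow> 'c::finite"
  shows "\<I>\<^bsub>p\<^esub>(X ; Y | Z) = (\<Sum>(x, y, z)\<in>UNIV.
     pmf (map_pmf (\<lambda>\<omega>. (X \<omega>, Y \<omega>, Z \<omega>)) p) (x, y, z) *
     log 2 (pmf (map_pmf (\<lambda>\<omega>. (X \<omega>, Y \<omega>, Z \<omega>)) p) (x, y, z) /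
       (pmf (map_pmf (\<lambda>\<omega>. (X \<omega>, Z \<omega>)) p) (x, z) *
        (pmf (map_pmf (\<lambda>\<omega>. (Y \<omega>, Z \<omega>)) p) (y, z) / pmf (map_pmf Z p) z))))"
proof -
  interpret information_space "measure_pmf p" 2
    by (intro information_space.intro measure_pmf.prob_space_axioms information_space_axioms.intro) simp
  have sd: "simple_distributed (measure_pmf p) W (pmf (map_pmf W p))" for W :: "'w \<Rightarrow> 'd::finite"
    by (rule prob_space.simple_distributedI[OF measure_pmf.prob_space_axioms])
       (auto simp: simple_function_def pmf_map intro: finite_subset[OF _ finite])
  have z: "pmf (map_pmf W p) w = 0" if "w \<notin> range W" for W :: "'w \<Rightarrow> 'd" and w
    using that by (auto simp: pmf_eq_0_set_pmf)
  show ?thesis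
    unfolding cond_mi_def
    by (subst conditional_mutual_information_eq[OF sd sd sd sd])
       (auto intro!: sum.mono_neutral_left z)
qed

end

theory Submission
  imports Defs "HOL-Real_Asymp.Real_Asymp"
begin

text \<open>
  Random coding, with the covering and joint-typicality arguments replaced by a one-shot bound.
  Given \<open>Q\<close>, the codewords \<open>u(m\<^sub>1, l\<^sub>1)\<close>, \<open>v(l\<^sub>2)\<close> and \<open>x\<^sub>2(m\<^sub>2)\<close> are drawn independently; encoder 1
  selects \<open>(l\<^sub>1, l\<^sub>2)\<close> with probability proportional to \<open>p(u, v | s) / (p(u) p(v))\<close>, and the decoders
  guess \<open>m\<^sub>1\<close> and \<open>m\<^sub>2\<close> with probability proportional to \<open>p(u, y\<^sub>1) / (p(u) p(y\<^sub>1))\<close> summed over \<open>l\<^sub>1\<close>, and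
  to \<open>p(v, x\<^sub>2, y\<^sub>2) / (p(v, x\<^sub>2) p(y\<^sub>2))\<close> summed over \<open>l\<^sub>2\<close>, so that \<open>l\<^sub>2\<close> need not be recovered.
  The probability of success is a sum of terms \<open>a / A * (N / (N + D))\<close>, where \<open>A\<close> and \<open>D\<close> are sums
  over competing codewords; by \<open>1 / (x y) \<ge> 3 - x - y\<close> it suffices to compute the mean of \<open>A\<close> and \<open>D\<close>
  given the transmitted codewords, which only involves pairs of independent codewords.  This leaves
  six inequalities between products of information ratios and codebook sizes.  With codebook rates
  \<open>I(U; Y\<^sub>1 | Q) - R\<^sub>1 - 2 \<delta>\<close> for \<open>l\<^sub>1\<close> and \<open>I(V, X\<^sub>2; Y\<^sub>2 | Q) - R\<^sub>2 - 2 \<delta>\<close> for \<open>l\<^sub>2\<close> they hold with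
  probability tending to one, by Chebyshev's inequality.
\<close>

section \<open>Expectations over finitely supported distributions\<close>

text \<open>A plain finite sum: on infinite support it is 0 by convention, so linearity,
  monotonicity and exchange of two expectations hold with no integrability condition. Agreement with
  the integral requires finite support.\<close>

definition expect :: "'a pmf \<Rightarrow> ('a \<Rightarrow> real) \<Rightarrow> real" where
  "expect p f = (\<Sum>x\<in>set_pmf p. pmf p x * f x)"

lemma expect_eq_integral: "finite (set_pmf p) \<Longrightarrow> expect p f = measure_pmf.expectation p f"
  unfolding expect_def by (subst integral_measure_pmf[of "set_pmf p"]) auto

lemma expect_superset:
  assumes "finite A" "set_pmf p \<subseteq> A"
  shows "expect p f = (\<Sum>x\<in>A. pmf p x * f x)"
  unfolding expect_def using assms by (intro sum.mono_neutral_left) (auto simp: pmf_eq_0_set_pmf)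

lemma expect_UNIV: "expect (p :: 'a::finite pmf) f = (\<Sum>x\<in>UNIV. pmf p x * f x)"
  by (rule expect_superset) auto

lemma expect_add: "expect p (\<lambda>x. f x + g x) = expect p f + expect p g"
  by (simp add: expect_def distrib_left sum.distrib)

lemma expect_diff: "expect p (\<lambda>x. f x - g x) = expect p f - expect p g"
  by (simp add: expect_def right_diff_distrib sum_subtractf)

lemma expect_cmult: "expect p (\<lambda>x. c * f x) = c * expect p f"
  by (simp add: expect_def sum_distrib_left mult.left_commute)

lemma expect_multc: "expect p (\<lambda>x. f x * c) = expect p f * c"
  by (simp add: expect_def sum_distrib_right mult.assoc)

lemma expect_divide: "expect p (\<lambda>x. f x / c) = expect p f / c"
  by (simp add: expect_def sum_divide_distrib)

lemma expect_sum: "expect p (\<lambda>x. \<Sum>i\<in>I. f i x) = (\<Sum>i\<in>I. expect p (f i))"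
  unfolding expect_def by (subst sum.swap) (simp add: sum_distrib_left)

lemma expect_swap: "expect p (\<lambda>x. expect q (\<lambda>y. f x y)) = expect q (\<lambda>y. expect p (\<lambda>x. f x y))"
  unfolding expect_def sum_distrib_left by (subst sum.swap) (simp add: mult_ac)

lemma expect_mono: "(\<And>x. x \<in> set_pmf p \<Longrightarrow> f x \<le> g x) \<Longrightarrow> expect p f \<le> expect p g"
  unfolding expect_def by (intro sum_mono mult_left_mono) auto

lemma expect_cong: "(\<And>x. x \<in> set_pmf p \<Longrightarrow> f x = g x) \<Longrightarrow> expect p f = expect p g"
  unfolding expect_def by (intro sum.cong) auto

lemma expect_nonneg: "(\<And>x. x \<in> set_pmf p \<Longrightarrow> 0 \<le> f x) \<Longrightarrow> 0 \<le> expect p f"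
  unfolding expect_def by (intro sum_nonneg) auto

lemma expect_const [simp]: "finite (set_pmf p) \<Longrightarrow> expect p (\<lambda>_. c) = c"
  unfolding expect_def by (simp add: sum_distrib_right[symmetric] sum_pmf_eq_1)

lemma expect_zero [simp]: "expect p (\<lambda>_. 0) = 0"
  by (simp add: expect_def)

lemma expect_return [simp]: "expect (return_pmf x) f = f x"
  by (simp add: expect_def)

lemma expect_bind:
  assumes "finite (set_pmf p)" "\<And>x. x \<in> set_pmf p \<Longrightarrow> finite (set_pmf (k x))"
  shows "expect (bind_pmf p k) f = expect p (\<lambda>x. expect (k x) f)"
proof -
  have "finite (set_pmf (bind_pmf p k))" using assms by auto
  hence "expect (bind_pmf p k) f = measure_pmf.expectation (bind_pmf p k) f"
    by (rule expect_eq_integral)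
  also have "\<dots> = (\<Sum>a\<in>set_pmf p. pmf p a *\<^sub>R measure_pmf.expectation (k a) f)"
    using assms by (intro pmf_expectation_bind) auto
  also have "\<dots> = expect p (\<lambda>x. expect (k x) f)"
    unfolding expect_def[of p] using assms by (intro sum.cong) (auto simp: expect_eq_integral)
  finally show ?thesis .
qed

lemma expect_map: "finite (set_pmf p) \<Longrightarrow> expect (map_pmf g p) f = expect p (\<lambda>x. f (g x))"
  unfolding map_pmf_def by (subst expect_bind) auto

lemma expect_pair:
  "expect (pair_pmf p q) f = expect p (\<lambda>x. expect q (\<lambda>y. f (x, y)))"
  unfolding expect_def
  by (simp add: sum.cartesian_product' pmf_pair sum_distrib_left mult.assoc)

lemma expect_prob:
  fixes p :: "'a pmf"
  shows "finite (set_pmf p) \<Longrightarrow> measure_pmf.prob p A = expect p (\<lambda>x. of_bool (x \<in> A))"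
proof -
  have "(\<lambda>x. of_bool (x \<in> A)) = (indicator A :: 'a \<Rightarrow> real)" by (auto simp: indicator_def)
  thus "measure_pmf.prob p A = expect p (\<lambda>x. of_bool (x \<in> A))" if "finite (set_pmf p)"
    using that by (simp add: expect_eq_integral)
qed

text \<open>The principle behind every derandomization below: an average is attained or exceeded at
  some point of the support, since strict inequality at every point would give
  \<open>expect p f < expect p f\<close>.\<close>

lemma expect_le_point:
  assumes "finite (set_pmf p)"
  shows "\<exists>x\<in>set_pmf p. expect p f \<le> f x"
proof (rule ccontr)
  assume "\<not> ?thesis"
  hence lt: "f x < expect p f" if "x \<in> set_pmf p" for x using that by auto
  have "expect p f < (\<Sum>x\<in>set_pmf p. pmf p x * expect p f)"
    unfolding expect_def[of p f] using assms set_pmf_not_empty[of p] 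
    by (intro sum_strict_mono) (auto intro!: mult_strict_left_mono lt[unfolded expect_def] simp: pmf_positive)
  also have "\<dots> = expect p f"
    using assms by (simp add: sum_distrib_right[symmetric] sum_pmf_eq_1)
  finally show False by simp
qed

section \<open>Marginals and moments of product laws\<close>

lemma finite_set_Pi_pmf [intro!]:
  assumes "finite A" "\<And>i. i \<in> A \<Longrightarrow> finite (set_pmf (p i))"
  shows "finite (set_pmf (Pi_pmf A d p))"
  using assms by (simp add: set_Pi_pmf finite_PiE_dflt)

lemma Pi_pmf_pair_marginal:
  assumes "finite A" "i \<in> A" "j \<in> A" "i \<noteq> j"
  shows "map_pmf (\<lambda>c. (c i, c j)) (Pi_pmf A d p) = pair_pmf (p i) (p j)"
proof -
  have A: "A = insert i (A - {i})" using assms by auto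
  have "Pi_pmf A d p = map_pmf (\<lambda>(y, f). f(i := y)) (pair_pmf (p i) (Pi_pmf (A - {i}) d p))"
    using assms by (subst A, subst Pi_pmf_insert) auto
  hence "map_pmf (\<lambda>c. (c i, c j)) (Pi_pmf A d p)
      = map_pmf (\<lambda>(y, f). (y, f j)) (pair_pmf (p i) (Pi_pmf (A - {i}) d p))"
    using assms by (simp add: pmf.map_comp o_def case_prod_unfold)
  also have "\<dots> = pair_pmf (p i) (map_pmf (\<lambda>f. f j) (Pi_pmf (A - {i}) d p))"
    using map_pair[of "\<lambda>y. y" "\<lambda>f. f j" "p i"] by (simp add: map_prod_def)
  also have "\<dots> = pair_pmf (p i) (p j)"
    using assms by (simp add: Pi_pmf_component)
  finally show ?thesis .
qed

lemma expect_Pi_component: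
  assumes "finite A" "\<And>i. i \<in> A \<Longrightarrow> finite (set_pmf (p i))" "i \<in> A"
  shows "expect (Pi_pmf A d p) (\<lambda>c. f (c i)) = expect (p i) f"
  using expect_map[of "Pi_pmf A d p" "\<lambda>c. c i" f] assms
  by (simp add: Pi_pmf_component finite_set_Pi_pmf)

lemma expect_Pi_pair:
  assumes "finite A" "\<And>i. i \<in> A \<Longrightarrow> finite (set_pmf (p i))" "i \<in> A" "j \<in> A" "i \<noteq> j"
  shows "expect (Pi_pmf A d p) (\<lambda>c. f (c i) (c j)) = expect (p i) (\<lambda>x. expect (p j) (f x))"
  using expect_map[of "Pi_pmf A d p" "\<lambda>c. (c i, c j)" "\<lambda>(x, y). f x y"] assms
  by (simp add: Pi_pmf_pair_marginal finite_set_Pi_pmf expect_pair)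

lemma expect_Pi_prod:
  assumes "finite A" "\<And>i. i \<in> A \<Longrightarrow> finite (set_pmf (p i))"
    and "\<And>i x. i \<in> A \<Longrightarrow> 0 \<le> f i x"
  shows "expect (Pi_pmf A d p) (\<lambda>c. \<Prod>i\<in>A. f i (c i)) = (\<Prod>i\<in>A. expect (p i) (f i))"
  using assms
  by (simp add: expect_eq_integral finite_set_Pi_pmf expectation_prod_Pi_pmf integrable_measure_pmf_finite)

lemma expect_Pi_sum_others:
  assumes "finite A" "finite (set_pmf p)" "i \<in> A" "I \<subseteq> A" "i \<notin> I"
  shows "expect (Pi_pmf A d (\<lambda>_. p)) (\<lambda>c. \<Sum>j\<in>I. f (c i) (c j))
    = card I * expect p (\<lambda>x. expect p (f x))"
proof -
  have "expect (Pi_pmf A d (\<lambda>_. p)) (\<lambda>c. f (c i) (c j)) = expect p (\<lambda>x. expect p (f x))"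
    if "j \<in> I" for j
    using assms that by (intro expect_Pi_pair) auto
  thus ?thesis by (simp add: expect_sum)
qed

text \<open>The index \<open>i\<close> may itself lie in \<open>I\<close>, and there both arguments
  are the same draw. This diagonal term is split off; all other terms involve two independent draws,
  and by nonnegativity they may be counted with the full \<open>card I\<close>.\<close>

lemma expect_Pi_sum_le:
  assumes "finite A" "finite (set_pmf p)" "i \<in> A" "I \<subseteq> A"
    and nonneg: "\<And>x y. 0 \<le> f x y"
  shows "expect (Pi_pmf A d (\<lambda>_. p)) (\<lambda>c. \<Sum>j\<in>I. f (c i) (c j))
    \<le> expect p (\<lambda>x. f x x) + card I * expect p (\<lambda>x. expect p (f x))"
proof -
  have fin: "finite I" using assms(1,4) by (rule finite_subset[rotated])
  have "expect (Pi_pmf A d (\<lambda>_. p)) (\<lambda>c. \<Sum>j\<in>I. f (c i) (c j))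
     \<le> expect (Pi_pmf A d (\<lambda>_. p)) (\<lambda>c. f (c i) (c i) + (\<Sum>j\<in>I - {i}. f (c i) (c j)))"
    using fin nonneg by (cases "i \<in> I") (auto intro!: expect_mono simp: sum.remove)
  also have "\<dots> = expect p (\<lambda>x. f x x) + card (I - {i}) * expect p (\<lambda>x. expect p (f x))"
    using assms by (simp add: expect_add expect_Pi_component[where f="\<lambda>x. f x x"] 
        expect_Pi_sum_others[where I="I - {i}"] subset_iff)
  also have "\<dots> \<le> expect p (\<lambda>x. f x x) + card I * expect p (\<lambda>x. expect p (f x))"
    using fin nonneg by (intro add_left_mono mult_right_mono expect_nonneg)
      (auto intro!: card_mono)
  finally show ?thesis .
qed

text \<open>The centered letters are orthogonal, so the variance of the sum is \<open>n\<close>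
  times that of one letter; dividing by \<open>(n * \<delta>)\<^sup>2\<close> leaves a bound of
  order \<open>1 / n\<close>.\<close>

lemma Pi_pmf_chebyshev:
  fixes P :: "'w::finite pmf" and n :: nat and \<delta> :: real
  assumes "n > 0" "\<delta> > 0"
  shows "measure_pmf.prob (Pi_pmf {1..n} d (\<lambda>_. P))
     {\<omega>. (\<Sum>i=1..n. g (\<omega> i)) \<ge> n * (expect P g + \<delta>)}
    \<le> expect P (\<lambda>x. (g x - expect P g)\<^sup>2) / (n * \<delta>\<^sup>2)"
proof -
  define \<mu> where "\<mu> = expect P g"
  define h where "h x = g x - \<mu>" for x
  define V where "V = expect P (\<lambda>x. (h x)\<^sup>2)"
  let ?P = "Pi_pmf {1..n} d (\<lambda>_. P)"
  have fin: "finite (set_pmf ?P)" by auto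
  have h0: "expect P h = 0" by (simp add: h_def[abs_def] expect_diff \<mu>_def)
  have cross: "expect ?P (\<lambda>\<omega>. h (\<omega> i) * h (\<omega> j)) = (if i = j then V else 0)"
    if "i \<in> {1..n}" "j \<in> {1..n}" for i j
  proof (cases "i = j")
    case True
    thus ?thesis using that expect_Pi_component[of "{1..n}" "\<lambda>_. P" i d "\<lambda>x. (h x)\<^sup>2"]
      by (simp add: V_def power2_eq_square)
  next
    case False
    thus ?thesis using that expect_Pi_pair[of "{1..n}" "\<lambda>_. P" i j d "\<lambda>x y. h x * h y"]
      by (simp add: expect_cmult h0)
  qed
  have var: "expect ?P (\<lambda>\<omega>. (\<Sum>i=1..n. h (\<omega> i))\<^sup>2) = n * V"
  proof -
    have "expect ?P (\<lambda>\<omega>. (\<Sum>i=1..n. h (\<omega> i))\<^sup>2) =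
        (\<Sum>i=1..n. \<Sum>j=1..n. expect ?P (\<lambda>\<omega>. h (\<omega> i) * h (\<omega> j)))"
      by (simp add: power2_eq_square sum_product expect_sum)
    also have "\<dots> = (\<Sum>i=1..n. \<Sum>j=1..n. if i = j then V else 0)"
      by (intro sum.cong refl cross)
    also have "\<dots> = n * V" by simp
    finally show ?thesis .
  qed
  have "measure_pmf.prob ?P {\<omega>. (\<Sum>i=1..n. g (\<omega> i)) \<ge> n * (\<mu> + \<delta>)}
      = expect ?P (\<lambda>\<omega>. of_bool ((\<Sum>i=1..n. g (\<omega> i)) \<ge> n * (\<mu> + \<delta>)))"
    using fin by (simp add: expect_prob)
  also have "\<dots> \<le> expect ?P (\<lambda>\<omega>. (\<Sum>i=1..n. h (\<omega> i))\<^sup>2 / (n * \<delta>)\<^sup>2)"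
  proof (rule expect_mono)
    fix \<omega>
    show "of_bool ((\<Sum>i=1..n. g (\<omega> i)) \<ge> n * (\<mu> + \<delta>)) \<le> (\<Sum>i=1..n. h (\<omega> i))\<^sup>2 / (n * \<delta>)\<^sup>2"
    proof (cases "(\<Sum>i=1..n. g (\<omega> i)) \<ge> n * (\<mu> + \<delta>)")
      case True
      hence "n * \<delta> \<le> (\<Sum>i=1..n. h (\<omega> i))"
        by (simp add: h_def sum_subtractf algebra_simps)
      hence "(n * \<delta>)\<^sup>2 \<le> (\<Sum>i=1..n. h (\<omega> i))\<^sup>2"
        using assms by (intro power_mono) auto
      thus ?thesis using True assms by simp
    qed simp
  qed
  also have "\<dots> = V / (n * \<delta>\<^sup>2)"
    unfolding expect_divide var using assms by (simp add: power2_eq_square)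
  finally show ?thesis by (simp add: V_def h_def \<mu>_def)
qed

section \<open>One-shot coding\<close>

text \<open>AM-GM for \<open>x\<close>, \<open>y\<close> and \<open>1 / (x * y)\<close>, whose
  product is 1: adding \<open>ln z \<le> z - 1\<close> over the three numbers cancels the
  logarithms.\<close>

lemma inverse_prod_ge:
  fixes x y :: real
  assumes "0 < x" "0 < y"
  shows "3 - x - y \<le> 1 / (x * y)"
proof -
  have ln: "ln z \<le> z - 1" if "0 < z" for z :: real using that by (rule ln_le_minus_one)
  have "ln x \<le> x - 1" "ln y \<le> y - 1" "ln (1 / (x * y)) \<le> 1 / (x * y) - 1"
    using assms by (auto intro!: ln)
  moreover have "ln (1 / (x * y)) = - ln x - ln y"
    using assms by (simp add: ln_div ln_mult)
  ultimately show ?thesis by linarith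
qed

text \<open>The right-hand side is the success probability of a likelihood encoder and decoder; the
  left-hand side is affine in \<open>A\<close> and \<open>D\<close>, so that their correlation is irrelevant when averaging.\<close>
lemma likelihood_product_bound:
  fixes a A N N0 D n :: real
  assumes "0 \<le> a" "a \<le> A" "0 < N0" "N0 \<le> N" "0 \<le> D" "0 < n"
  shows "a / n * (2 - A / n - D / N0) \<le> a / A * (N / (N + D))"
proof (cases "a = 0")
  case False
  hence A: "0 < A" using assms by auto
  \<comment> \<open>Writing 2 as 3 - 1 turns \<open>D / N0\<close> into \<open>1 + D / N0\<close>,
    the reciprocal of \<open>N0 / (N0 + D)\<close>; enlarging \<open>N0\<close> to \<open>N\<close>
    then only helps.\<close>
  have "2 - A / n - D / N0 = 3 - A / n - (1 + D / N0)" by simp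
  also have "\<dots> \<le> 1 / (A / n * (1 + D / N0))"
    using A assms by (intro inverse_prod_ge) (auto intro: add_pos_nonneg)
  also have "\<dots> = n / A * (1 / (1 + D / N0))" by simp
  also have "\<dots> \<le> n / A * (1 / (1 + D / N))"
    using A assms by (intro mult_left_mono divide_left_mono add_left_mono)
      (auto intro!: mult_pos_pos add_pos_nonneg)
  also have "1 / (1 + D / N) = N / (N + D)"
    using assms by (simp add: field_simps)
  finally have "a / n * (2 - A / n - D / N0) \<le> a / n * (n / A * (N / (N + D)))"
    using assms by (intro mult_left_mono) auto
  thus ?thesis using assms by simp
qed auto

text \<open>A maximizer of \<open>\<phi>\<close> works. Mass missing from \<open>e\<close> does no
  harm because \<open>\<phi>\<close> is nonnegative.\<close>

lemma subprob_sum_le_point: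
  fixes e \<phi> :: "'i \<Rightarrow> real"
  assumes "finite I" "I \<noteq> {}" "\<And>i. i \<in> I \<Longrightarrow> 0 \<le> e i" "sum e I \<le> 1" "\<And>i. i \<in> I \<Longrightarrow> 0 \<le> \<phi> i"
  shows "\<exists>i\<in>I. (\<Sum>i\<in>I. e i * \<phi> i) \<le> \<phi> i"
proof -
  have "Max (\<phi> ` I) \<in> \<phi> ` I" using assms by (intro Max_in) auto
  then obtain i where i: "i \<in> I" "\<phi> i = Max (\<phi> ` I)" by auto
  have "(\<Sum>j\<in>I. e j * \<phi> j) \<le> (\<Sum>j\<in>I. e j * \<phi> i)"
    using assms i by (intro sum_mono mult_left_mono) auto
  also have "\<dots> = sum e I * \<phi> i" by (simp add: sum_distrib_right)
  also have "\<dots> \<le> 1 * \<phi> i" using assms i(1) by (intro mult_right_mono) auto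
  finally show ?thesis using i(1) by auto
qed

text \<open>A wrong guess of the maximizing decoder has a rival of at least the same metric, hence
  likelihood at most 1/2 for the true message: derandomizing costs a factor of 2.\<close>
lemma likelihood_maximizer:
  fixes N :: "'m \<Rightarrow> real"
  assumes "finite I" "I \<noteq> {}" and nonneg: "\<And>m. m \<in> I \<Longrightarrow> 0 \<le> N m"
  shows "\<exists>g\<in>I. \<forall>m\<in>I. of_bool (g \<noteq> m) \<le> 2 * (1 - N m / sum N I)"
proof -
  have "Max (N ` I) \<in> N ` I" using assms by (intro Max_in) auto
  then obtain g where g: "g \<in> I" "N g = Max (N ` I)" by auto
  have "of_bool (g \<noteq> m) \<le> 2 * (1 - N m / sum N I)" if m: "m \<in> I" for m
  proof (cases "g = m")
    case True
    have "N m \<le> sum N I" using m nonneg assms by (intro member_le_sum) auto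
    hence "N m / sum N I \<le> 1" using sum_nonneg[of I N] nonneg 
      by (cases "sum N I = 0") (auto simp: field_simps)
    thus ?thesis using True by simp
  next
    case False
    have "N m \<le> N g" using m assms g by auto
    moreover have "N m + N g \<le> sum N I"
    proof -
      have "N m + N g = sum N {m, g}" using False by auto
      also have "\<dots> \<le> sum N I" using m g nonneg assms by (intro sum_mono2) auto
      finally show ?thesis .
    qed
    ultimately have le: "2 * N m \<le> sum N I" by linarith
    have "of_bool (g \<noteq> m) = (1 :: real)" using False by simp
    moreover have "N m / sum N I \<le> 1 / 2"
    proof (cases "sum N I = 0")
      case False
      hence "0 < sum N I" using sum_nonneg[of I N] nonneg by fastforce
      thus ?thesis using le by (simp add: field_simps)
    qed simp
    moreover have "1 \<le> 2 * (1 - x)" if "x \<le> 1 / 2" for x :: real using that by simp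
    ultimately have "of_bool (g \<noteq> m) = (1 :: real)" "1 \<le> 2 * (1 - N m / sum N I)" by blast+
    thus ?thesis by (rule ord_eq_le_trans)
  qed
  thus ?thesis using g by blast
qed

text \<open>\<open>w s\<close> is the density of the law of \<open>(U, V)\<close> given the state with respect to \<open>QU \<times> QV\<close>, and \<open>wU\<close>,
  \<open>wV\<close> are (bounds on) its marginal densities.  The decoding metrics \<open>h\<close> and \<open>k\<close> are arbitrary up to
  normalization.  \<open>T1\<close> and \<open>T2\<close> are typicality predicates for the two receivers.\<close>
locale one_shot =
  fixes PS :: "'s pmf" and QU :: "'u pmf" and QV :: "'v pmf" and QX :: "'b pmf"
    and K :: "'u \<Rightarrow> 'v \<Rightarrow> 's \<Rightarrow> 'a pmf"
    and C1 :: "'a \<Rightarrow> 's \<Rightarrow> 'c pmf" and C2 :: "'a \<Rightarrow> 'b \<Rightarrow> 's \<Rightarrow> 'd pmf"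
    and w :: "'s \<Rightarrow> 'u \<Rightarrow> 'v \<Rightarrow> real" and wU :: "'s \<Rightarrow> 'u \<Rightarrow> real" and wV :: "'s \<Rightarrow> 'v \<Rightarrow> real"
    and h :: "'u \<Rightarrow> 'c \<Rightarrow> real" and k :: "'v \<Rightarrow> 'b \<Rightarrow> 'd \<Rightarrow> real" and k' :: "'v \<Rightarrow> 'd \<Rightarrow> real"
    and T1 :: "'s \<Rightarrow> 'u \<Rightarrow> 'v \<Rightarrow> 'c \<Rightarrow> bool" and T2 :: "'s \<Rightarrow> 'u \<Rightarrow> 'v \<Rightarrow> 'b \<Rightarrow> 'd \<Rightarrow> bool"
    and M1 M2 L1 L2 :: nat and \<eta> :: real
  assumes fin [simp]: "finite (set_pmf PS)" "finite (set_pmf QU)" "finite (set_pmf QV)" "finite (set_pmf QX)"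
      "finite (set_pmf (K u v s))" "finite (set_pmf (C1 a s))" "finite (set_pmf (C2 a x s))"
    and pos: "0 < M1" "0 < M2" "0 < L1" "0 < L2" "0 < \<eta>"
    and w_nonneg: "0 \<le> w s u v" and h_nonneg: "0 \<le> h u y1" and k_nonneg: "0 \<le> k v x y2"
    and w_U: "expect QV (\<lambda>v. w s u v) \<le> wU s u"
    and w_V: "expect QU (\<lambda>u. w s u v) \<le> wV s v"
    and w_UV: "expect QU (\<lambda>u. expect QV (\<lambda>v. w s u v)) \<le> 1"
    and h_U: "expect QU (\<lambda>u. h u y1) \<le> 1"
    and k_X: "expect QX (\<lambda>x. k v x y2) \<le> k' v y2"
    and k_VX: "expect QV (\<lambda>v. expect QX (\<lambda>x. k v x y2)) \<le> 1"
    and T1_enc: "T1 s u v y1 \<Longrightarrow> wU s u \<le> \<eta> * L1 \<and> wV s v \<le> \<eta> * L2 \<and> w s u v \<le> \<eta> * (L1 * L2)"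
    and T2_enc: "T2 s u v x y2 \<Longrightarrow> wU s u \<le> \<eta> * L1 \<and> wV s v \<le> \<eta> * L2 \<and> w s u v \<le> \<eta> * (L1 * L2)"
    and T1_dec: "T1 s u v y1 \<Longrightarrow> M1 * L1 \<le> \<eta> * h u y1"
    and T2_dec: "T2 s u v x y2 \<Longrightarrow> M2 * k' v y2 \<le> \<eta> * k v x y2 \<and> M2 * L2 \<le> \<eta> * k v x y2"
begin

section \<open>Random codebooks, likelihood encoder and likelihood decoders\<close>

definition "BU = Pi_pmf ({1..M1} \<times> {1..L1}) undefined (\<lambda>_. QU)"
definition "BV = Pi_pmf {1..L2} undefined (\<lambda>_. QV)"
definition "BX = Pi_pmf {1..M2} undefined (\<lambda>_. QX)"

lemma fin_books [simp]: "finite (set_pmf BU)" "finite (set_pmf BV)" "finite (set_pmf BX)"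
  unfolding BU_def BV_def BX_def by (auto intro!: finite_set_Pi_pmf)

text \<open>Averaged over independent codewords, the density \<open>w\<close> turns this into the
  mass of the event \<open>T1\<close> under the law that \<open>w\<close> describes. That mass is
  \<open>G1\<close>, and likewise \<open>G2\<close> for \<open>T2\<close>; for block codes they
  become probabilities of typical sets.\<close>

definition \<Psi>1 :: "'s \<Rightarrow> 'u \<Rightarrow> 'v \<Rightarrow> real" where
  "\<Psi>1 s u v = w s u v * expect (K u v s) (\<lambda>a. expect (C1 a s) (\<lambda>y. of_bool (T1 s u v y)))"
definition \<Psi>2 :: "'s \<Rightarrow> 'u \<Rightarrow> 'v \<Rightarrow> 'b \<Rightarrow> real" where
  "\<Psi>2 s u v x = w s u v * expect (K u v s) (\<lambda>a. expect (C2 a x s) (\<lambda>y. of_bool (T2 s u v x y)))"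

definition G1 :: real where
  "G1 = expect PS (\<lambda>s. expect QU (\<lambda>u. expect QV (\<lambda>v. \<Psi>1 s u v)))"
definition G2 :: real where
  "G2 = expect PS (\<lambda>s. expect QU (\<lambda>u. expect QV (\<lambda>v. expect QX (\<lambda>x. \<Psi>2 s u v x))))"

text \<open>Normalizer of the likelihood encoder. The first index runs over positions of the
  codebook \<open>BU\<close>, in the form needed to average a sum over components of a product
  law.\<close>

definition enc_weight :: "'s \<Rightarrow> nat \<Rightarrow> (nat \<times> nat \<Rightarrow> 'u) \<Rightarrow> (nat \<Rightarrow> 'v) \<Rightarrow> real" where
  "enc_weight s m cu cv = (\<Sum>i\<in>{m} \<times> {1..L1}. \<Sum>j\<in>{1..L2}. w s (cu i) (cv j))"

definition metric1 :: "(nat \<times> nat \<Rightarrow> 'u) \<Rightarrow> nat \<Rightarrow> 'c \<Rightarrow> real" where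
  "metric1 cu m y = (\<Sum>i\<in>{m} \<times> {1..L1}. h (cu i) y)"
definition metric2 :: "(nat \<Rightarrow> 'v) \<Rightarrow> (nat \<Rightarrow> 'b) \<Rightarrow> nat \<Rightarrow> 'd \<Rightarrow> real" where
  "metric2 cv cx m y = (\<Sum>j\<in>{1..L2}. k (cv j) (cx m) y)"
text \<open>Probability that the randomized decoder outputs \<open>m\<close>. If all metrics vanish
  it is 0 for every \<open>m\<close>, which can only lower the success probability.\<close>

definition soft1 :: "(nat \<times> nat \<Rightarrow> 'u) \<Rightarrow> nat \<Rightarrow> 'c \<Rightarrow> real" where
  "soft1 cu m y = metric1 cu m y / (\<Sum>m'\<in>{1..M1}. metric1 cu m' y)"
definition soft2 :: "(nat \<Rightarrow> 'v) \<Rightarrow> (nat \<Rightarrow> 'b) \<Rightarrow> nat \<Rightarrow> 'd \<Rightarrow> real" where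
  "soft2 cv cx m y = metric2 cv cx m y / (\<Sum>m'\<in>{1..M2}. metric2 cv cx m' y)"

lemma metric_nonneg: "0 \<le> metric1 cu m y1" "0 \<le> metric2 cv cx m y2"
  by (auto simp: metric1_def metric2_def intro!: sum_nonneg h_nonneg k_nonneg)

lemma soft_nonneg: "0 \<le> soft1 cu m y1" "0 \<le> soft2 cv cx m y2"
  by (auto simp: soft1_def soft2_def intro!: divide_nonneg_nonneg sum_nonneg metric_nonneg)

lemma \<Psi>_nonneg: "0 \<le> \<Psi>1 s u v" "0 \<le> \<Psi>2 s u v x"
  by (auto simp: \<Psi>1_def \<Psi>2_def intro!: mult_nonneg_nonneg expect_nonneg w_nonneg)

text \<open>Second-moment count of mutual covering. The pairs of codewords competing with
  \<open>(l1, l2)\<close> fall into four classes: the pair itself, same \<open>u\<close> with fresh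
  \<open>v\<close>, same \<open>v\<close> with fresh \<open>u\<close>, and both fresh. On the
  support of \<open>\<Psi>\<close> each of the first three contributes at most
  \<open>\<eta> * L1 * L2\<close>, by the bounds on \<open>w\<close>, \<open>wU\<close> and
  \<open>wV\<close>; the last contributes at most \<open>L1 * L2\<close> by
  \<open>w_UV\<close>.\<close>

lemma expect_enc_weight_le:
  assumes m: "m \<in> {1..M1}" "l1 \<in> {1..L1}" "l2 \<in> {1..L2}"
    and \<Psi>: "\<And>u v. 0 \<le> \<Psi> u v"
      "\<And>u v. \<Psi> u v \<noteq> 0 \<Longrightarrow> wU s u \<le> \<eta> * L1 \<and> wV s v \<le> \<eta> * L2 \<and> w s u v \<le> \<eta> * (L1 * L2)"
  shows "expect BU (\<lambda>cu. expect BV (\<lambda>cv. \<Psi> (cu (m, l1)) (cv l2) * enc_weight s m cu cv))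
    \<le> L1 * L2 * (1 + 3 * \<eta>) * expect QU (\<lambda>u. expect QV (\<lambda>v. \<Psi> u v))"
proof -
  \<comment> \<open>The book of \<open>v\<close> is averaged first, with both \<open>u\<close>
    codewords held fixed, so that the diagonal splitting can be applied to one book at a
    time.\<close>
  define \<Phi> where "\<Phi> u u' = expect BV (\<lambda>cv. \<Sum>j\<in>{1..L2}. \<Psi> u (cv l2) * w s u' (cv j))" for u u'
  define e where "e = expect QU (\<lambda>u. expect QV (\<lambda>v. \<Psi> u v))"
  have \<Phi>0: "0 \<le> \<Phi> u u'" for u u'
    unfolding \<Phi>_def by (intro expect_nonneg sum_nonneg mult_nonneg_nonneg \<Psi> w_nonneg)
  have \<Phi>: "\<Phi> u u' \<le> expect QV (\<lambda>v. \<Psi> u v * w s u' v) + L2 * expect QV (\<lambda>v. expect QV (\<lambda>v'. \<Psi> u v * w s u' v'))"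
    for u u'
    using expect_Pi_sum_le[of "{1..L2}" QV l2 "{1..L2}" "\<lambda>v v'. \<Psi> u v * w s u' v'" undefined] m
    by (simp add: \<Phi>_def BV_def \<Psi> w_nonneg)
  have "expect BU (\<lambda>cu. expect BV (\<lambda>cv. \<Psi> (cu (m, l1)) (cv l2) * enc_weight s m cu cv))
     = expect BU (\<lambda>cu. \<Sum>i\<in>{m} \<times> {1..L1}. \<Phi> (cu (m, l1)) (cu i))"
    by (simp add: enc_weight_def sum_distrib_left \<Phi>_def expect_sum)
  also have "\<dots> \<le> expect QU (\<lambda>u. \<Phi> u u) + card ({m} \<times> {1..L1}) * expect QU (\<lambda>u. expect QU (\<Phi> u))"
    unfolding BU_def using m by (intro expect_Pi_sum_le \<Phi>0) auto
  also have "\<dots> = expect QU (\<lambda>u. \<Phi> u u) + L1 * expect QU (\<lambda>u. expect QU (\<Phi> u))"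
    by simp
  finally have main: "expect BU (\<lambda>cu. expect BV (\<lambda>cv. \<Psi> (cu (m, l1)) (cv l2) * enc_weight s m cu cv))
     \<le> expect QU (\<lambda>u. \<Phi> u u) + L1 * expect QU (\<lambda>u. expect QU (\<Phi> u))" .
  \<comment> \<open>Same \<open>u\<close>: one term with the same \<open>v\<close> and up to
    \<open>L2\<close> terms with a fresh \<open>v\<close>, each class costing
    \<open>\<eta> * L1 * L2\<close>.\<close>
  have "expect QU (\<lambda>u. \<Phi> u u) \<le> expect QU (\<lambda>u. expect QV (\<lambda>v. \<Psi> u v * (\<eta> * (L1 * L2))) + L2 * expect QV (\<lambda>v. \<Psi> u v * (\<eta> * L1)))"
  proof (intro expect_mono order_trans[OF \<Phi>] add_mono)
    fix u v
    \<comment> \<open>The thresholds are available only where \<open>\<Psi>\<close> is nonzero;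
      elsewhere both sides vanish.\<close>
    show "\<Psi> u v * w s u v \<le> \<Psi> u v * (\<eta> * (L1 * L2))"
      using \<Psi> by (cases "\<Psi> u v = 0") (auto intro!: mult_left_mono)
    have le: "expect QV (\<lambda>v'. \<Psi> u v * w s u v') \<le> \<Psi> u v * (\<eta> * L1)" for v
    proof -
      have "\<Psi> u v * expect QV (\<lambda>v'. w s u v') \<le> \<Psi> u v * (\<eta> * L1)"
        using \<Psi> w_U[of s u] by (cases "\<Psi> u v = 0") (auto intro!: mult_left_mono elim: order_trans)
      thus ?thesis by (simp add: expect_cmult)
    qed
    show "L2 * expect QV (\<lambda>v. expect QV (\<lambda>v'. \<Psi> u v * w s u v')) \<le> L2 * expect QV (\<lambda>v. \<Psi> u v * (\<eta> * L1))"
      by (intro mult_left_mono expect_mono le) auto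
  qed
  also have "\<dots> = 2 * \<eta> * (L1 * L2) * e"
    by (simp add: expect_multc expect_add expect_cmult e_def algebra_simps)
  finally have diag: "expect QU (\<lambda>u. \<Phi> u u) \<le> 2 * \<eta> * (L1 * L2) * e" .
  \<comment> \<open>Fresh \<open>u\<close>: the same \<open>v\<close> costs
    \<open>\<eta> * L2\<close> and the up to \<open>L2\<close> fresh ones cost 1 each. Multiplying
    by \<open>L1\<close> gives the main term.\<close>
  have "expect QU (\<lambda>u. expect QU (\<Phi> u)) \<le> expect QU (\<lambda>u. expect QV (\<lambda>v. \<Psi> u v * (\<eta> * L2)) + L2 * expect QV (\<lambda>v. \<Psi> u v * 1))"
  proof (intro expect_mono)
    fix u
    have 1: "\<Psi> u v * expect QU (\<lambda>u'. w s u' v) \<le> \<Psi> u v * (\<eta> * L2)" for v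
      using \<Psi> w_V[of s v] by (cases "\<Psi> u v = 0") (auto intro!: mult_left_mono elim: order_trans)
    have 2: "\<Psi> u v * expect QU (\<lambda>u'. expect QV (\<lambda>v'. w s u' v')) \<le> \<Psi> u v * 1" for v
      using \<Psi> w_UV[of s] by (intro mult_left_mono) auto
    have "expect QU (\<Phi> u) \<le> expect QU (\<lambda>u'. expect QV (\<lambda>v. \<Psi> u v * w s u' v) + L2 * expect QV (\<lambda>v. expect QV (\<lambda>v'. \<Psi> u v * w s u' v')))"
      by (intro expect_mono \<Phi>)
    also have "\<dots> = expect QV (\<lambda>v. \<Psi> u v * expect QU (\<lambda>u'. w s u' v))
        + L2 * expect QV (\<lambda>v. \<Psi> u v * expect QU (\<lambda>u'. expect QV (\<lambda>v'. w s u' v')))"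
      by (simp add: expect_add expect_cmult expect_swap[of QU QV])
    also have "\<dots> \<le> expect QV (\<lambda>v. \<Psi> u v * (\<eta> * L2)) + L2 * expect QV (\<lambda>v. \<Psi> u v * 1)"
      by (intro add_mono expect_mono mult_left_mono 1 2) auto
    finally show "expect QU (\<Phi> u) \<le> \<dots>" .
  qed
  also have "\<dots> = (1 + \<eta>) * L2 * e"
    by (simp add: expect_multc expect_add expect_cmult e_def algebra_simps)
  finally have "L1 * expect QU (\<lambda>u. expect QU (\<Phi> u)) \<le> L1 * ((1 + \<eta>) * L2 * e)"
    by (intro mult_left_mono) auto
  with main diag show ?thesis unfolding e_def[symmetric] by (simp add: algebra_simps)
qed

section \<open>Mean metric of the competing codewords\<close>

lemma expect_book_U: "i \<in> {1..M1} \<times> {1..L1} \<Longrightarrow> expect BU (\<lambda>cu. f (cu i)) = expect QU f"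
  unfolding BU_def by (rule expect_Pi_component) auto
lemma expect_book_V: "j \<in> {1..L2} \<Longrightarrow> expect BV (\<lambda>cv. f (cv j)) = expect QV f"
  unfolding BV_def by (rule expect_Pi_component) auto
lemma expect_book_X: "m \<in> {1..M2} \<Longrightarrow> expect BX (\<lambda>cx. f (cx m)) = expect QX f"
  unfolding BX_def by (rule expect_Pi_component) auto

lemma T1_h_pos: "T1 s u v y \<Longrightarrow> 0 < h u y"
  using T1_dec[of s u v y] pos by (smt (verit) mult_nonneg_nonpos mult_pos_pos of_nat_0_less_iff)

lemma T2_k_pos: "T2 s u v x y \<Longrightarrow> 0 < k v x y"
  using T2_dec[of s u v x y] pos by (smt (verit) mult_nonneg_nonpos mult_pos_pos of_nat_0_less_iff)

text \<open>Codewords of other messages are independent of the transmitted one and hence of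
  \<open>y\<close>, so each has mean metric at most 1 by \<open>h_U\<close>. There are fewer than
  \<open>M1 * L1\<close> of them, and \<open>T1_dec\<close> bounds \<open>M1 * L1 / h u y\<close> by
  \<open>\<eta>\<close>.\<close>

lemma expect_competing1_le:
  assumes m: "m \<in> {1..M1}" "l1 \<in> {1..L1}" "l2 \<in> {1..L2}"
  shows "expect BU (\<lambda>cu. expect BV (\<lambda>cv. w s (cu (m, l1)) (cv l2) *
       expect (K (cu (m, l1)) (cv l2) s) (\<lambda>a. expect (C1 a s) (\<lambda>y.
         of_bool (T1 s (cu (m, l1)) (cv l2) y) *
         ((\<Sum>i\<in>({1..M1} - {m}) \<times> {1..L1}. h (cu i) y) / h (cu (m, l1)) y)))))
    \<le> \<eta> * expect QU (\<lambda>u. expect QV (\<Psi>1 s u))"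
proof -
  define r where "r u v y = of_bool (T1 s u v y) / h u y" for u v y
  define f where "f u u' = expect QV (\<lambda>v. w s u v * expect (K u v s) (\<lambda>a. expect (C1 a s) (\<lambda>y.
         r u v y * h u' y)))" for u u'
  let ?I = "({1..M1} - {m}) \<times> {1..L1}"
  have "expect BU (\<lambda>cu. expect BV (\<lambda>cv. w s (cu (m, l1)) (cv l2) *
       expect (K (cu (m, l1)) (cv l2) s) (\<lambda>a. expect (C1 a s) (\<lambda>y.
         of_bool (T1 s (cu (m, l1)) (cv l2) y) *
         ((\<Sum>i\<in>?I. h (cu i) y) / h (cu (m, l1)) y)))))
     = expect BU (\<lambda>cu. \<Sum>i\<in>?I. f (cu (m, l1)) (cu i))"
    using m(3) by (subst expect_book_V[OF m(3)])
      (simp add: f_def r_def sum_distrib_left sum_divide_distrib expect_sum)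
  also have "\<dots> = card ?I * expect QU (\<lambda>u. expect QU (f u))"
    unfolding BU_def using m by (intro expect_Pi_sum_others) auto
  also have "\<dots> \<le> (M1 * L1) * expect QU (\<lambda>u. expect QU (f u))"
  proof (intro mult_right_mono)
    show "real (card ?I) \<le> real (M1 * L1)"
      using m by (simp add: card_cartesian_product mult_right_mono)
    show "0 \<le> expect QU (\<lambda>u. expect QU (f u))" unfolding f_def r_def
      by (intro expect_nonneg mult_nonneg_nonneg w_nonneg divide_nonneg_nonneg h_nonneg) auto
  qed
  \<comment> \<open>The average over the competing codeword \<open>u'\<close> is moved innermost, so
    that \<open>h_U\<close> applies for each fixed output \<open>y\<close>.\<close>
  also have "\<dots> = expect QU (\<lambda>u. expect QV (\<lambda>v. w s u v * expect (K u v s) (\<lambda>a. expect (C1 a s) (\<lambda>y.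
         (M1 * L1) * (r u v y * expect QU (\<lambda>u'. h u' y))))))"
    unfolding f_def by (simp add: expect_swap[of QU QV] expect_swap[of QU "C1 _ s"] expect_swap[of QU "K _ _ _"] expect_cmult expect_multc mult_ac)
  also have "\<dots> \<le> expect QU (\<lambda>u. expect QV (\<lambda>v. w s u v * expect (K u v s) (\<lambda>a. expect (C1 a s) (\<lambda>y.
         \<eta> * of_bool (T1 s u v y)))))"
  proof (intro expect_mono mult_left_mono w_nonneg)
    fix u v y
    show "(M1 * L1) * (r u v y * expect QU (\<lambda>u'. h u' y)) \<le> \<eta> * of_bool (T1 s u v y)"
    proof (cases "T1 s u v y")
      case True
      have "(M1 * L1) * (1 / h u y * expect QU (\<lambda>u'. h u' y)) \<le> (M1 * L1) * (1 / h u y * 1)"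
        using T1_h_pos[OF True] h_U[of y] by (intro mult_left_mono) auto
      also have "\<dots> \<le> \<eta>" using T1_h_pos[OF True] T1_dec[OF True] by (simp add: field_simps)
      finally show ?thesis using True by (simp add: r_def)
    qed (simp add: r_def)
  qed
  also have "\<dots> = \<eta> * expect QU (\<lambda>u. expect QV (\<Psi>1 s u))"
    by (simp add: \<Psi>1_def[abs_def] expect_cmult mult.left_commute[of _ \<eta>])
  finally show ?thesis .
qed

text \<open>Every competitor has a fresh \<open>x2\<close>, because its message differs. Those with
  the same \<open>l2\<close> share the transmitted \<open>v\<close> and are controlled by
  \<open>k_X\<close> and the first half of \<open>T2_dec\<close>; those with another
  \<open>l2\<close> also have a fresh \<open>v\<close> and are controlled by \<open>k_VX\<close> and
  the second half. Each kind costs \<open>\<eta>\<close>.\<close>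

lemma expect_competing2_le:
  assumes m: "m1 \<in> {1..M1}" "m \<in> {1..M2}" "l1 \<in> {1..L1}" "l2 \<in> {1..L2}"
  shows "expect BU (\<lambda>cu. expect BV (\<lambda>cv. expect BX (\<lambda>cx. w s (cu (m1, l1)) (cv l2) *
       expect (K (cu (m1, l1)) (cv l2) s) (\<lambda>a. expect (C2 a (cx m) s) (\<lambda>y.
         of_bool (T2 s (cu (m1, l1)) (cv l2) (cx m) y) *
         ((\<Sum>m'\<in>{1..M2} - {m}. \<Sum>j\<in>{1..L2}. k (cv j) (cx m') y) / k (cv l2) (cx m) y))))))
    \<le> 2 * \<eta> * expect QU (\<lambda>u. expect QV (\<lambda>v. expect QX (\<Psi>2 s u v)))"
proof -
  define r where "r u v x y = of_bool (T2 s u v x y) / k v x y" for u v x y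
  define f where "f u v x v' x' = w s u v * expect (K u v s) (\<lambda>a. expect (C2 a x s) (\<lambda>y.
         r u v x y * k v' x' y))" for u v x v' x'
  \<comment> \<open>With \<open>u\<close> and both \<open>x2\<close> codewords averaged out, only
    two positions of the book of \<open>v\<close> remain, possibly the same one.\<close>
  define F where "F v v' = expect QU (\<lambda>u. expect QX (\<lambda>x. expect QX (\<lambda>x'. f u v x v' x')))" for v v'
  define e where "e = expect QU (\<lambda>u. expect QV (\<lambda>v. expect QX (\<Psi>2 s u v)))"
  have f_nonneg: "0 \<le> f u v x v' x'" for u v x v' x'
    unfolding f_def r_def by (intro expect_nonneg mult_nonneg_nonneg w_nonneg divide_nonneg_nonneg k_nonneg) auto
  let ?I = "{1..M2} - {m}"
  have "expect BU (\<lambda>cu. expect BV (\<lambda>cv. expect BX (\<lambda>cx. w s (cu (m1, l1)) (cv l2) *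
       expect (K (cu (m1, l1)) (cv l2) s) (\<lambda>a. expect (C2 a (cx m) s) (\<lambda>y.
         of_bool (T2 s (cu (m1, l1)) (cv l2) (cx m) y) *
         ((\<Sum>m'\<in>?I. \<Sum>j\<in>{1..L2}. k (cv j) (cx m') y) / k (cv l2) (cx m) y))))))
    = expect QU (\<lambda>u. expect BV (\<lambda>cv. expect BX (\<lambda>cx. \<Sum>m'\<in>?I. \<Sum>j\<in>{1..L2}. f u (cv l2) (cx m) (cv j) (cx m'))))"
    using m by (subst expect_book_U[of "(m1, l1)"])
      (simp_all add: f_def r_def sum_distrib_left sum_divide_distrib expect_sum)
  also have "\<dots> = expect QU (\<lambda>u. expect BV (\<lambda>cv. card ?I *
      expect QX (\<lambda>x. expect QX (\<lambda>x'. \<Sum>j\<in>{1..L2}. f u (cv l2) x (cv j) x'))))"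
    unfolding BX_def using m
    by (intro expect_cong expect_Pi_sum_others[where f="\<lambda>x x'. \<Sum>j\<in>{1..L2}. f _ (_ l2) x (_ j) x'"]) auto
  also have "\<dots> = card ?I * expect BV (\<lambda>cv. \<Sum>j\<in>{1..L2}. F (cv l2) (cv j))"
    by (simp add: F_def expect_cmult expect_sum expect_swap[of QU BV])
  also have "\<dots> \<le> M2 * expect BV (\<lambda>cv. \<Sum>j\<in>{1..L2}. F (cv l2) (cv j))"
  proof (intro mult_right_mono)
    show "real (card ?I) \<le> real M2" using card_mono[of "{1..M2}" ?I] by auto
    show "0 \<le> expect BV (\<lambda>cv. \<Sum>j\<in>{1..L2}. F (cv l2) (cv j))" unfolding F_def
      by (intro expect_nonneg sum_nonneg f_nonneg)
  qed
  also have "\<dots> \<le> M2 * (expect QV (\<lambda>v. F v v) + L2 * expect QV (\<lambda>v. expect QV (F v)))"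
  proof (intro mult_left_mono)
    have "0 \<le> F v v'" for v v' unfolding F_def by (intro expect_nonneg f_nonneg)
    thus "expect BV (\<lambda>cv. \<Sum>j\<in>{1..L2}. F (cv l2) (cv j))
       \<le> expect QV (\<lambda>v. F v v) + L2 * expect QV (\<lambda>v. expect QV (F v))"
      using expect_Pi_sum_le[of "{1..L2}" QV l2 "{1..L2}" F undefined] m by (simp add: BV_def)
  qed auto
  also have "\<dots> = M2 * expect QV (\<lambda>v. F v v) + M2 * L2 * expect QV (\<lambda>v. expect QV (F v))"
    by (simp add: algebra_simps)
  \<comment> \<open>Competitors sharing the transmitted \<open>v\<close>.\<close>
  also have "M2 * expect QV (\<lambda>v. F v v) = expect QV (\<lambda>v. expect QU (\<lambda>u. expect QX (\<lambda>x. 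
      w s u v * expect (K u v s) (\<lambda>a. expect (C2 a x s) (\<lambda>y.
         M2 * (r u v x y * expect QX (\<lambda>x'. k v x' y)))))))"
    unfolding F_def f_def by (simp add: expect_swap[of QX "C2 _ _ s"] expect_swap[of QX "K _ _ _"] expect_cmult expect_multc mult_ac)
  also have "\<dots> \<le> expect QV (\<lambda>v. expect QU (\<lambda>u. expect QX (\<lambda>x. 
      w s u v * expect (K u v s) (\<lambda>a. expect (C2 a x s) (\<lambda>y. \<eta> * of_bool (T2 s u v x y))))))"
  proof (intro expect_mono mult_left_mono w_nonneg)
    fix u v x y
    show "M2 * (r u v x y * expect QX (\<lambda>x'. k v x' y)) \<le> \<eta> * of_bool (T2 s u v x y)"
    proof (cases "T2 s u v x y")
      case True
      have "M2 * (1 / k v x y * expect QX (\<lambda>x'. k v x' y)) \<le> M2 * (1 / k v x y * k' v y)"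
        using T2_k_pos[OF True] k_X[of v y] by (intro mult_left_mono) auto
      also have "\<dots> \<le> \<eta>" using T2_k_pos[OF True] T2_dec[OF True] by (simp add: field_simps)
      finally show ?thesis using True by (simp add: r_def)
    qed (simp add: r_def)
  qed
  also have "\<dots> = \<eta> * e"
    by (simp add: \<Psi>2_def[abs_def] expect_cmult mult.left_commute[of _ \<eta>] e_def expect_swap[of QV QU])
  \<comment> \<open>Competitors with a fresh \<open>v\<close>.\<close>
  also have "M2 * L2 * expect QV (\<lambda>v. expect QV (F v)) = expect QV (\<lambda>v. expect QU (\<lambda>u. expect QX (\<lambda>x. 
      w s u v * expect (K u v s) (\<lambda>a. expect (C2 a x s) (\<lambda>y.
         (M2 * L2) * (r u v x y * expect QV (\<lambda>v'. expect QX (\<lambda>x'. k v' x' y))))))))"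
    unfolding F_def f_def by (simp add: expect_swap[of QX "C2 _ _ s"] expect_swap[of QX "K _ _ _"]
       expect_swap[of QV "C2 _ _ s"] expect_swap[of QV "K _ _ _"] expect_swap[of QV QU] expect_swap[of QV QX] expect_cmult expect_multc mult_ac)
  also have "\<dots> \<le> expect QV (\<lambda>v. expect QU (\<lambda>u. expect QX (\<lambda>x. 
      w s u v * expect (K u v s) (\<lambda>a. expect (C2 a x s) (\<lambda>y. \<eta> * of_bool (T2 s u v x y))))))"
  proof (intro expect_mono mult_left_mono w_nonneg)
    fix u v x y
    show "(M2 * L2) * (r u v x y * expect QV (\<lambda>v'. expect QX (\<lambda>x'. k v' x' y))) \<le> \<eta> * of_bool (T2 s u v x y)"
    proof (cases "T2 s u v x y")
      case True
      have "(M2 * L2) * (1 / k v x y * expect QV (\<lambda>v'. expect QX (\<lambda>x'. k v' x' y))) \<le> (M2 * L2) * (1 / k v x y * 1)"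
        using T2_k_pos[OF True] k_VX[of y] by (intro mult_left_mono) auto
      also have "\<dots> \<le> \<eta>" using T2_k_pos[OF True] T2_dec[OF True] by (simp add: field_simps)
      finally show ?thesis using True by (simp add: r_def)
    qed (simp add: r_def)
  qed
  also have "\<dots> = \<eta> * e"
    by (simp add: \<Psi>2_def[abs_def] expect_cmult mult.left_commute[of _ \<eta>] e_def expect_swap[of QV QU])
  finally show ?thesis unfolding e_def by simp
qed

section \<open>Success probability of the randomized code\<close>

lemma metric1_total:
  assumes "m \<in> {1..M1}"
  shows "(\<Sum>m'\<in>{1..M1}. metric1 cu m' y) = metric1 cu m y + (\<Sum>i\<in>({1..M1} - {m}) \<times> {1..L1}. h (cu i) y)"
  using assms unfolding metric1_def by (subst sum.remove[of _ m]) (simp_all add: sum.cartesian_product')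

lemma metric2_total:
  assumes "m \<in> {1..M2}"
  shows "(\<Sum>m'\<in>{1..M2}. metric2 cv cx m' y) = metric2 cv cx m y + (\<Sum>m'\<in>{1..M2} - {m}. \<Sum>j\<in>{1..L2}. k (cv j) (cx m') y)"
  using assms unfolding metric2_def by (subst sum.remove[of _ m]) simp_all

lemma w_le_enc_weight:
  assumes "l1 \<in> {1..L1}" "l2 \<in> {1..L2}"
  shows "w s (cu (m, l1)) (cv l2) \<le> enc_weight s m cu cv"
proof -
  have "w s (cu (m, l1)) (cv l2) \<le> (\<Sum>j\<in>{1..L2}. w s (cu (m, l1)) (cv j))"
    using assms by (intro member_le_sum[of l2]) (auto intro: w_nonneg)
  also have "\<dots> \<le> enc_weight s m cu cv"
    unfolding enc_weight_def using assms 
    by (intro member_le_sum[of "(m, l1)"]) (auto intro!: sum_nonneg w_nonneg)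
  finally show ?thesis .
qed

text \<open>The likelihood bound is affine in the encoder's normalizer and in the competing metric,
  so their means from the two preceding estimates can be inserted. The result is the share of one
  index pair \<open>(l1, l2)\<close>; summation over the \<open>L1 * L2\<close> pairs removes the
  denominator.\<close>

lemma expect_correct1_ge:
  assumes m: "m \<in> {1..M1}" "l1 \<in> {1..L1}" "l2 \<in> {1..L2}"
  shows "(1 - 5 * \<eta>) / (L1 * L2) * expect QU (\<lambda>u. expect QV (\<Psi>1 s u))
    \<le> expect BU (\<lambda>cu. expect BV (\<lambda>cv. w s (cu (m, l1)) (cv l2) / enc_weight s m cu cv *
        expect (K (cu (m, l1)) (cv l2) s) (\<lambda>a. expect (C1 a s) (\<lambda>y. soft1 cu m y))))"
proof -
  define e where "e = expect QU (\<lambda>u. expect QV (\<Psi>1 s u))"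
  define n where "n = real (L1 * L2)"
  define D where "D cu y = (\<Sum>i\<in>({1..M1} - {m}) \<times> {1..L1}. h (cu i) y)" for cu :: "nat \<times> nat \<Rightarrow> 'u" and y
  define Z where "Z cu cv = w s (cu (m, l1)) (cv l2) *
       expect (K (cu (m, l1)) (cv l2) s) (\<lambda>a. expect (C1 a s) (\<lambda>y.
         of_bool (T1 s (cu (m, l1)) (cv l2) y) * (D cu y / h (cu (m, l1)) y)))" for cu cv
  have n: "0 < n" using pos by (simp add: n_def)
  have e: "0 \<le> e" unfolding e_def by (intro expect_nonneg \<Psi>_nonneg)
  have "expect BU (\<lambda>cu. expect BV (\<lambda>cv. \<Psi>1 s (cu (m, l1)) (cv l2))) = expect BV (\<lambda>cv. expect QU (\<lambda>u. \<Psi>1 s u (cv l2)))"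
    using m by (subst expect_swap, intro expect_cong expect_book_U[where f="\<lambda>u. \<Psi>1 s u (_ l2)"]) auto
  also have "\<dots> = e"
    using m unfolding e_def by (subst expect_book_V) (auto simp: expect_swap[of QV])
  finally have 1: "expect BU (\<lambda>cu. expect BV (\<lambda>cv. \<Psi>1 s (cu (m, l1)) (cv l2))) = e" .
  have 2: "expect BU (\<lambda>cu. expect BV (\<lambda>cv. \<Psi>1 s (cu (m, l1)) (cv l2) * enc_weight s m cu cv))
      \<le> n * (1 + 3 * \<eta>) * e"
    unfolding e_def n_def
  proof (rule expect_enc_weight_le[OF m, where \<Psi>="\<Psi>1 s"])
    show "0 \<le> \<Psi>1 s u v" for u v by (rule \<Psi>_nonneg)
    fix u v assume "\<Psi>1 s u v \<noteq> 0"
    then obtain y where "T1 s u v y" unfolding \<Psi>1_def by (cases "\<exists>y. T1 s u v y") auto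
    thus "wU s u \<le> \<eta> * L1 \<and> wV s v \<le> \<eta> * L2 \<and> w s u v \<le> \<eta> * (L1 * L2)" by (rule T1_enc)
  qed
  have 3: "expect BU (\<lambda>cu. expect BV (Z cu)) \<le> \<eta> * e"
    unfolding Z_def[abs_def] D_def e_def using expect_competing1_le[OF m] by simp
  \<comment> \<open>The loss here is only \<open>3 * \<eta>\<close> from the encoder and
    \<open>\<eta>\<close> from the decoder; it is weakened to match receiver 2.\<close>
  have "(1 - 5 * \<eta>) / n * e \<le> (2 * e - n * (1 + 3 * \<eta>) * e / n - \<eta> * e) / n"
    using n pos e by (simp add: field_simps)
  also have "\<dots> \<le> (2 * e - expect BU (\<lambda>cu. expect BV (\<lambda>cv. \<Psi>1 s (cu (m, l1)) (cv l2) * enc_weight s m cu cv)) / n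
     - expect BU (\<lambda>cu. expect BV (Z cu))) / n"
    using 2 3 n by (intro divide_right_mono diff_mono) auto
  also have "\<dots> = expect BU (\<lambda>cu. expect BV (\<lambda>cv. (2 * \<Psi>1 s (cu (m, l1)) (cv l2)
      - \<Psi>1 s (cu (m, l1)) (cv l2) * enc_weight s m cu cv / n - Z cu cv) / n))"
    by (simp add: expect_diff expect_divide expect_cmult 1)
  also have "\<dots> \<le> expect BU (\<lambda>cu. expect BV (\<lambda>cv. w s (cu (m, l1)) (cv l2) / enc_weight s m cu cv *
        expect (K (cu (m, l1)) (cv l2) s) (\<lambda>a. expect (C1 a s) (\<lambda>y. soft1 cu m y))))"
  proof (intro expect_mono)
    fix cu cv
    define A where "A = enc_weight s m cu cv"
    define u v where uv: "u = cu (m, l1)" "v = cv l2"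
    \<comment> \<open>Coefficients free of the channel input and output, so that the three terms
      merge under one expectation.\<close>
    define c1 c2 where c_def: "c1 = w s u v / n * (2 - A / n)" "c2 = w s u v / n"
    have A: "w s u v \<le> A" unfolding uv A_def using m by (intro w_le_enc_weight) auto
    have "(2 * \<Psi>1 s u v - \<Psi>1 s u v * A / n - Z cu cv) / n =
      expect (K u v s) (\<lambda>a. expect (C1 a s) (\<lambda>y. 
         c1 * of_bool (T1 s u v y) - c2 * (of_bool (T1 s u v y) * (D cu y / h u y))))"
      using n unfolding \<Psi>1_def Z_def uv[symmetric] expect_cmult expect_diff by (simp add: c_def field_simps)
    also have "\<dots> = expect (K u v s) (\<lambda>a. expect (C1 a s) (\<lambda>y.
         of_bool (T1 s u v y) * (w s u v / n * (2 - A / n - D cu y / h u y))))"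
      by (simp add: c_def algebra_simps)
    also have "\<dots> \<le> expect (K u v s) (\<lambda>a. expect (C1 a s) (\<lambda>y. w s u v / A * soft1 cu m y))"
    proof (intro expect_mono)
      fix y
      show "of_bool (T1 s u v y) * (w s u v / n * (2 - A / n - D cu y / h u y)) \<le> w s u v / A * soft1 cu m y"
      proof (cases "T1 s u v y")
        case True
        have "h u y \<le> metric1 cu m y"
          unfolding metric1_def uv using m by (intro member_le_sum[of "(m, l1)"]) (auto intro: h_nonneg)
        moreover have "0 \<le> D cu y" unfolding D_def by (intro sum_nonneg h_nonneg)
        moreover have "soft1 cu m y = metric1 cu m y / (metric1 cu m y + D cu y)"
          unfolding soft1_def metric1_total[OF m(1)] D_def ..
        ultimately show ?thesis
          using True likelihood_product_bound[OF w_nonneg A T1_h_pos[OF True] _ _ n, of "metric1 cu m y" "D cu y"]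
          by simp
      next
        case False
        have "0 \<le> A" using A w_nonneg[of s u v] by linarith
        thus ?thesis using False by (auto intro!: mult_nonneg_nonneg divide_nonneg_nonneg w_nonneg soft_nonneg)
      qed
    qed
    finally show "(2 * \<Psi>1 s (cu (m, l1)) (cv l2) - \<Psi>1 s (cu (m, l1)) (cv l2) * enc_weight s m cu cv / n - Z cu cv) / n
       \<le> w s (cu (m, l1)) (cv l2) / enc_weight s m cu cv *
        expect (K (cu (m, l1)) (cv l2) s) (\<lambda>a. expect (C1 a s) (\<lambda>y. soft1 cu m y))"
      by (simp add: uv A_def expect_cmult expect_divide)
  qed
  finally show ?thesis by (simp add: e_def n_def)
qed

text \<open>As for receiver 1. Since the encoder's normalizer does not see the book of
  \<open>x2\<close>, the codeword \<open>x2\<close> is averaged out of \<open>\<Psi>2\<close> before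
  the encoder estimate is applied. The losses \<open>3 * \<eta>\<close> and
  \<open>2 * \<eta>\<close> add up to \<open>5 * \<eta>\<close>.\<close>

lemma expect_correct2_ge:
  assumes m: "m1 \<in> {1..M1}" "m \<in> {1..M2}" "l1 \<in> {1..L1}" "l2 \<in> {1..L2}"
  shows "(1 - 5 * \<eta>) / (L1 * L2) * expect QU (\<lambda>u. expect QV (\<lambda>v. expect QX (\<Psi>2 s u v)))
    \<le> expect BU (\<lambda>cu. expect BV (\<lambda>cv. expect BX (\<lambda>cx. w s (cu (m1, l1)) (cv l2) / enc_weight s m1 cu cv *
        expect (K (cu (m1, l1)) (cv l2) s) (\<lambda>a. expect (C2 a (cx m) s) (\<lambda>y. soft2 cv cx m y)))))"
proof -
  define e where "e = expect QU (\<lambda>u. expect QV (\<lambda>v. expect QX (\<Psi>2 s u v)))"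
  define n where "n = real (L1 * L2)"
  define D where "D cv cx y = (\<Sum>m'\<in>{1..M2} - {m}. \<Sum>j\<in>{1..L2}. k (cv j) (cx m') y)"
    for cv :: "nat \<Rightarrow> 'v" and cx :: "nat \<Rightarrow> 'b" and y
  define Z where "Z cu cv cx = w s (cu (m1, l1)) (cv l2) *
       expect (K (cu (m1, l1)) (cv l2) s) (\<lambda>a. expect (C2 a (cx m) s) (\<lambda>y.
         of_bool (T2 s (cu (m1, l1)) (cv l2) (cx m) y) * (D cv cx y / k (cv l2) (cx m) y)))" for cu cv cx
  define \<Psi> where "\<Psi> u v = expect QX (\<Psi>2 s u v)" for u v
  have n: "0 < n" using pos by (simp add: n_def)
  have e: "0 \<le> e" unfolding e_def by (intro expect_nonneg \<Psi>_nonneg)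
  have e\<Psi>: "e = expect QU (\<lambda>u. expect QV (\<lambda>v. \<Psi> u v))" by (simp add: e_def \<Psi>_def)
  have X: "expect BX (\<lambda>cx. \<Psi>2 s u v (cx m)) = \<Psi> u v" for u v
    unfolding \<Psi>_def using m by (intro expect_book_X)
  have "expect BU (\<lambda>cu. expect BV (\<lambda>cv. \<Psi> (cu (m1, l1)) (cv l2))) = expect BV (\<lambda>cv. expect QU (\<lambda>u. \<Psi> u (cv l2)))"
    using m by (subst expect_swap, intro expect_cong expect_book_U[where f="\<lambda>u. \<Psi> u (_ l2)"]) auto
  also have "\<dots> = e"
    using m unfolding e_def by (subst expect_book_V) (auto simp: expect_swap[of QV QU] \<Psi>_def)
  finally have 1: "expect BU (\<lambda>cu. expect BV (\<lambda>cv. \<Psi> (cu (m1, l1)) (cv l2))) = e" .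
  have 2: "expect BU (\<lambda>cu. expect BV (\<lambda>cv. \<Psi> (cu (m1, l1)) (cv l2) * enc_weight s m1 cu cv))
      \<le> n * (1 + 3 * \<eta>) * e"
    unfolding e\<Psi> n_def
  proof (rule expect_enc_weight_le[OF m(1,3,4), where \<Psi>=\<Psi>])
    show "0 \<le> \<Psi> u v" for u v unfolding \<Psi>_def by (intro expect_nonneg \<Psi>_nonneg)
    fix u v assume "\<Psi> u v \<noteq> 0"
    then obtain x y where "T2 s u v x y" unfolding \<Psi>_def \<Psi>2_def by (cases "\<exists>x y. T2 s u v x y") auto
    thus "wU s u \<le> \<eta> * L1 \<and> wV s v \<le> \<eta> * L2 \<and> w s u v \<le> \<eta> * (L1 * L2)" by (rule T2_enc)
  qed
  have 3: "expect BU (\<lambda>cu. expect BV (\<lambda>cv. expect BX (Z cu cv))) \<le> 2 * \<eta> * e"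
    unfolding Z_def[abs_def] D_def e_def using expect_competing2_le[OF m] by simp
  have "(1 - 5 * \<eta>) / n * e = (2 * e - n * (1 + 3 * \<eta>) * e / n - 2 * \<eta> * e) / n"
    using n by (simp add: field_simps)
  also have "\<dots> \<le> (2 * e - expect BU (\<lambda>cu. expect BV (\<lambda>cv. \<Psi> (cu (m1, l1)) (cv l2) * enc_weight s m1 cu cv)) / n
     - expect BU (\<lambda>cu. expect BV (\<lambda>cv. expect BX (Z cu cv)))) / n"
    using 2 3 n by (intro divide_right_mono diff_mono) auto
  also have "\<dots> = expect BU (\<lambda>cu. expect BV (\<lambda>cv. expect BX (\<lambda>cx. (2 * \<Psi>2 s (cu (m1, l1)) (cv l2) (cx m)
      - \<Psi>2 s (cu (m1, l1)) (cv l2) (cx m) * enc_weight s m1 cu cv / n - Z cu cv cx) / n)))"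
    by (simp add: expect_diff expect_divide expect_cmult expect_multc 1 X)
  also have "\<dots> \<le> expect BU (\<lambda>cu. expect BV (\<lambda>cv. expect BX (\<lambda>cx. w s (cu (m1, l1)) (cv l2) / enc_weight s m1 cu cv *
        expect (K (cu (m1, l1)) (cv l2) s) (\<lambda>a. expect (C2 a (cx m) s) (\<lambda>y. soft2 cv cx m y)))))"
  proof (intro expect_mono)
    fix cu cv and cx :: "nat \<Rightarrow> 'b"
    define A where "A = enc_weight s m1 cu cv"
    define u v x where uv: "u = cu (m1, l1)" "v = cv l2" "x = cx m"
    define c1 c2 where c_def: "c1 = w s u v / n * (2 - A / n)" "c2 = w s u v / n"
    have A: "w s u v \<le> A" unfolding uv A_def using m by (intro w_le_enc_weight) auto
    have "(2 * \<Psi>2 s u v x - \<Psi>2 s u v x * A / n - Z cu cv cx) / n =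
      expect (K u v s) (\<lambda>a. expect (C2 a x s) (\<lambda>y. 
         c1 * of_bool (T2 s u v x y) - c2 * (of_bool (T2 s u v x y) * (D cv cx y / k v x y))))"
      using n unfolding \<Psi>2_def Z_def uv[symmetric] expect_cmult expect_diff by (simp add: c_def field_simps)
    also have "\<dots> = expect (K u v s) (\<lambda>a. expect (C2 a x s) (\<lambda>y.
         of_bool (T2 s u v x y) * (w s u v / n * (2 - A / n - D cv cx y / k v x y))))"
      by (simp add: c_def algebra_simps)
    also have "\<dots> \<le> expect (K u v s) (\<lambda>a. expect (C2 a x s) (\<lambda>y. w s u v / A * soft2 cv cx m y))"
    proof (intro expect_mono)
      fix y
      show "of_bool (T2 s u v x y) * (w s u v / n * (2 - A / n - D cv cx y / k v x y)) \<le> w s u v / A * soft2 cv cx m y"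
      proof (cases "T2 s u v x y")
        case True
        have "k v x y \<le> metric2 cv cx m y"
          unfolding metric2_def uv using m by (intro member_le_sum[of l2]) (auto intro: k_nonneg)
        moreover have "0 \<le> D cv cx y" unfolding D_def by (intro sum_nonneg k_nonneg)
        moreover have "soft2 cv cx m y = metric2 cv cx m y / (metric2 cv cx m y + D cv cx y)"
          unfolding soft2_def metric2_total[OF m(2)] D_def ..
        ultimately show ?thesis
          using True likelihood_product_bound[OF w_nonneg A T2_k_pos[OF True] _ _ n, of "metric2 cv cx m y" "D cv cx y"]
          by simp
      next
        case False
        have "0 \<le> A" using A w_nonneg[of s u v] by linarith
        thus ?thesis using False by (auto intro!: mult_nonneg_nonneg divide_nonneg_nonneg w_nonneg soft_nonneg)
      qed
    qed
    finally show "(2 * \<Psi>2 s (cu (m1, l1)) (cv l2) (cx m) - \<Psi>2 s (cu (m1, l1)) (cv l2) (cx m) * enc_weight s m1 cu cv / n - Z cu cv cx) / n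
       \<le> w s (cu (m1, l1)) (cv l2) / enc_weight s m1 cu cv *
        expect (K (cu (m1, l1)) (cv l2) s) (\<lambda>a. expect (C2 a (cx m) s) (\<lambda>y. soft2 cv cx m y))"
      by (simp add: uv A_def expect_cmult expect_divide)
  qed
  finally show ?thesis by (simp add: e_def n_def)
qed

text \<open>Randomness is removed in stages: the three codebooks, then the selected index pair, then
  the channel input drawn from \<open>K\<close>, and finally the decoders. Working throughout with
  the sum of both success probabilities yields choices that serve both receivers at once.\<close>

lemma exists_code:
  "\<exists>F1 F2 g1 g2. (\<forall>y. g1 y \<in> {1..M1}) \<and> (\<forall>y. g2 y \<in> {1..M2}) \<and>
     expect (pmf_of_set {1..M1}) (\<lambda>m1. expect PS (\<lambda>s. expect (C1 (F1 m1 s) s) (\<lambda>y. of_bool (g1 y \<noteq> m1)))) +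
     expect (pmf_of_set {1..M1}) (\<lambda>m1. expect (pmf_of_set {1..M2}) (\<lambda>m2.
       expect PS (\<lambda>s. expect (C2 (F1 m1 s) (F2 m2) s) (\<lambda>y. of_bool (g2 y \<noteq> m2)))))
     \<le> 2 * (2 - (1 - 5 * \<eta>) * (G1 + G2))"
proof -
  note One_nat_def [simp del]
  let ?U1 = "pmf_of_set {1..M1}" and ?U2 = "pmf_of_set {1..M2}"
  have U [simp]: "set_pmf ?U1 = {1..M1}" "set_pmf ?U2 = {1..M2}" using pos by auto
  \<comment> \<open>The message \<open>m2\<close> is averaged inside, because encoder 1 has to
    choose its input \<open>a\<close> without knowing it.\<close>
  define \<Phi> where "\<Phi> cu cv cx m s a = expect (C1 a s) (soft1 cu m) +
      expect ?U2 (\<lambda>m2. expect (C2 a (cx m2) s) (soft2 cv cx m2))" for cu cv cx m s a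
  define e where "e s cu cv m l = w s (cu (m, fst l)) (cv (snd l)) / enc_weight s m cu cv" for s cu cv m l
  define Enc where "Enc cu cv cx m s = (\<Sum>l\<in>{1..L1} \<times> {1..L2}. e s cu cv m l *
      expect (K (cu (m, fst l)) (cv (snd l)) s) (\<Phi> cu cv cx m s))" for cu cv cx m s
  define \<gamma>1 where "\<gamma>1 s = expect QU (\<lambda>u. expect QV (\<Psi>1 s u))" for s
  define \<gamma>2 where "\<gamma>2 s = expect QU (\<lambda>u. expect QV (\<lambda>v. expect QX (\<Psi>2 s u v)))" for s
  have \<Phi>_nonneg: "0 \<le> \<Phi> cu cv cx m s a" for cu cv cx m s a
    unfolding \<Phi>_def by (intro add_nonneg_nonneg expect_nonneg soft_nonneg)
  have Enc: "(1 - 5 * \<eta>) * (\<gamma>1 s + \<gamma>2 s) \<le> expect BU (\<lambda>cu. expect BV (\<lambda>cv. expect BX (\<lambda>cx. Enc cu cv cx m s)))"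
    if m: "m \<in> {1..M1}" for m s
  proof -
    \<comment> \<open>The target is split into equal shares over the index pairs, and the share of
      receiver 2 is written as a constant average over \<open>m2\<close>, so as to match the
      encoder's sum term by term.\<close>
    have "(1 - 5 * \<eta>) * (\<gamma>1 s + \<gamma>2 s) = (\<Sum>l\<in>{1..L1} \<times> {1..L2}.
        (1 - 5 * \<eta>) / (L1 * L2) * \<gamma>1 s + expect ?U2 (\<lambda>m2. (1 - 5 * \<eta>) / (L1 * L2) * \<gamma>2 s))"
      using pos by (simp add: field_simps)
    also have "\<dots> \<le> (\<Sum>l\<in>{1..L1} \<times> {1..L2}.
        expect BU (\<lambda>cu. expect BV (\<lambda>cv. e s cu cv m l *
          expect (K (cu (m, fst l)) (cv (snd l)) s) (\<lambda>a. expect (C1 a s) (soft1 cu m)))) +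
        expect ?U2 (\<lambda>m2. expect BU (\<lambda>cu. expect BV (\<lambda>cv. expect BX (\<lambda>cx. e s cu cv m l *
          expect (K (cu (m, fst l)) (cv (snd l)) s) (\<lambda>a. expect (C2 a (cx m2) s) (soft2 cv cx m2)))))))"
      unfolding \<gamma>1_def \<gamma>2_def e_def using m
      by (intro sum_mono add_mono expect_mono expect_correct1_ge expect_correct2_ge) auto
    also have "\<dots> = expect BU (\<lambda>cu. expect BV (\<lambda>cv. expect BX (\<lambda>cx. Enc cu cv cx m s)))"
      unfolding Enc_def \<Phi>_def
      by (simp add: expect_sum expect_add expect_cmult distrib_left sum.distrib
         expect_swap[of ?U2 BU] expect_swap[of ?U2 BV] expect_swap[of ?U2 BX] expect_swap[of "K _ _ _" ?U2])
    finally show ?thesis .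
  qed
  have "(1 - 5 * \<eta>) * (G1 + G2) = expect ?U1 (\<lambda>m. expect PS (\<lambda>s. (1 - 5 * \<eta>) * (\<gamma>1 s + \<gamma>2 s)))"
    by (simp add: expect_cmult expect_add G1_def G2_def \<gamma>1_def \<gamma>2_def)
  also have "\<dots> \<le> expect ?U1 (\<lambda>m. expect PS (\<lambda>s. expect BU (\<lambda>cu. expect BV (\<lambda>cv. expect BX (\<lambda>cx. Enc cu cv cx m s)))))"
    by (intro expect_mono Enc) auto
  also have "\<dots> = expect BU (\<lambda>cu. expect BV (\<lambda>cv. expect BX (\<lambda>cx. expect ?U1 (\<lambda>m. expect PS (\<lambda>s. Enc cu cv cx m s)))))"
    by (simp add: expect_swap[of ?U1 BU] expect_swap[of ?U1 BV] expect_swap[of ?U1 BX]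
       expect_swap[of PS BU] expect_swap[of PS BV] expect_swap[of PS BX])
  finally obtain cu cv cx where c: "(1 - 5 * \<eta>) * (G1 + G2) \<le> expect ?U1 (\<lambda>m. expect PS (\<lambda>s. Enc cu cv cx m s))"
    by (meson expect_le_point fin_books order_trans)
  \<comment> \<open>The encoder's weights \<open>e\<close> vanish altogether when \<open>enc_weight\<close> is 0 (division by zero), so they
    only form a subprobability.\<close>
  have "\<exists>a. Enc cu cv cx m s \<le> \<Phi> cu cv cx m s a" for m s
  proof -
    have nonneg: "0 \<le> e s cu cv m l" for l
      unfolding e_def enc_weight_def by (intro divide_nonneg_nonneg sum_nonneg w_nonneg)
    have "sum (e s cu cv m) ({1..L1} \<times> {1..L2}) = enc_weight s m cu cv / enc_weight s m cu cv"
      unfolding e_def sum_divide_distrib[symmetric]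
      by (simp add: enc_weight_def sum.cartesian_product')
    also have "\<dots> \<le> 1" by simp
    finally have "\<exists>l\<in>{1..L1} \<times> {1..L2}.
        Enc cu cv cx m s \<le> expect (K (cu (m, fst l)) (cv (snd l)) s) (\<Phi> cu cv cx m s)"
      unfolding Enc_def using pos
      by (intro subprob_sum_le_point nonneg expect_nonneg \<Phi>_nonneg) auto
    then obtain l where "Enc cu cv cx m s \<le> expect (K (cu (m, fst l)) (cv (snd l)) s) (\<Phi> cu cv cx m s)"
      by blast
    thus ?thesis by (meson expect_le_point fin order_trans)
  qed
  then obtain F1 where F1: "\<And>m s. Enc cu cv cx m s \<le> \<Phi> cu cv cx m s (F1 m s)" by metis
  have "\<forall>y. \<exists>g\<in>{1..M1}. \<forall>m\<in>{1..M1}. of_bool (g \<noteq> m) \<le> 2 * (1 - soft1 cu m y)"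
    unfolding soft1_def using pos by (intro allI likelihood_maximizer metric_nonneg) auto
  then obtain g1 where g1: "\<And>y. g1 y \<in> {1..M1}" 
      "\<And>y m. m \<in> {1..M1} \<Longrightarrow> of_bool (g1 y \<noteq> m) \<le> 2 * (1 - soft1 cu m y)" by metis
  have "\<forall>y. \<exists>g\<in>{1..M2}. \<forall>m\<in>{1..M2}. of_bool (g \<noteq> m) \<le> 2 * (1 - soft2 cv cx m y)"
    unfolding soft2_def using pos by (intro allI likelihood_maximizer metric_nonneg) auto
  then obtain g2 where g2: "\<And>y. g2 y \<in> {1..M2}" 
      "\<And>y m. m \<in> {1..M2} \<Longrightarrow> of_bool (g2 y \<noteq> m) \<le> 2 * (1 - soft2 cv cx m y)" by metis
  have "expect ?U1 (\<lambda>m1. expect PS (\<lambda>s. expect (C1 (F1 m1 s) s) (\<lambda>y. of_bool (g1 y \<noteq> m1)))) +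
     expect ?U1 (\<lambda>m1. expect ?U2 (\<lambda>m2.
       expect PS (\<lambda>s. expect (C2 (F1 m1 s) (cx m2) s) (\<lambda>y. of_bool (g2 y \<noteq> m2)))))
    \<le> expect ?U1 (\<lambda>m1. expect PS (\<lambda>s. expect (C1 (F1 m1 s) s) (\<lambda>y. 2 * (1 - soft1 cu m1 y)))) +
     expect ?U1 (\<lambda>m1. expect ?U2 (\<lambda>m2.
       expect PS (\<lambda>s. expect (C2 (F1 m1 s) (cx m2) s) (\<lambda>y. 2 * (1 - soft2 cv cx m2 y)))))"
    by (intro add_mono expect_mono g1 g2) auto
  also have "\<dots> = 2 * (2 - expect ?U1 (\<lambda>m1. expect PS (\<lambda>s. \<Phi> cu cv cx m1 s (F1 m1 s))))"
    by (simp add: \<Phi>_def expect_cmult expect_diff expect_add expect_swap[of ?U2 PS] algebra_simps)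
  also have "\<dots> \<le> 2 * (2 - expect ?U1 (\<lambda>m1. expect PS (\<lambda>s. Enc cu cv cx m1 s)))"
    by (intro mult_left_mono diff_left_mono expect_mono F1) auto
  also have "\<dots> \<le> 2 * (2 - (1 - 5 * \<eta>) * (G1 + G2))" using c by simp
  finally show ?thesis using g1(1) g2(1) by blast
qed

end

section \<open>Information ratios and the single-letter law\<close>

text \<open>This is \<open>p(x, y | z) / (p(x | z) p(y | z))\<close>; its logarithm is the
  conditional information density, with mean the conditional mutual information.\<close>

definition info_ratio :: "'w pmf \<Rightarrow> ('w \<Rightarrow> 'a) \<Rightarrow> ('w \<Rightarrow> 'b) \<Rightarrow> ('w \<Rightarrow> 'c) \<Rightarrow> 'a \<Rightarrow> 'b \<Rightarrow> 'c \<Rightarrow> real" where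
  "info_ratio p X Y Z x y z = pmf (map_pmf (\<lambda>\<omega>. (X \<omega>, Y \<omega>, Z \<omega>)) p) (x, y, z) /
     (pmf (map_pmf (\<lambda>\<omega>. (X \<omega>, Z \<omega>)) p) (x, z) *
      (pmf (map_pmf (\<lambda>\<omega>. (Y \<omega>, Z \<omega>)) p) (y, z) / pmf (map_pmf Z p) z))"

lemma cond_mi_eq_expect:
  fixes p :: "'w::finite pmf" and X :: "'w \<Rightarrow> 'a::finite" and Y :: "'w \<Rightarrow> 'b::finite" and Z :: "'w \<Rightarrow> 'c::finite"
  shows "\<I>\<^bsub>p\<^esub>(X ; Y | Z) = expect p (\<lambda>\<omega>. log 2 (info_ratio p X Y Z (X \<omega>) (Y \<omega>) (Z \<omega>)))"
proof -
  have "\<I>\<^bsub>p\<^esub>(X ; Y | Z) = expect (map_pmf (\<lambda>\<omega>. (X \<omega>, Y \<omega>, Z \<omega>)) p) (\<lambda>(x, y, z). log 2 (info_ratio p X Y Z x y z))"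
    unfolding cond_mi_eq_sum expect_UNIV info_ratio_def by (intro sum.cong) auto
  thus ?thesis by (simp add: expect_map)
qed

lemma simple_function_finite: "simple_function (measure_pmf p) (W :: 'w \<Rightarrow> 'a::finite)"
  by (auto simp: simple_function_def intro: finite_subset[OF _ finite])

lemma cond_mi_nonneg:
  fixes p :: "'w pmf" and X :: "'w \<Rightarrow> 'a::finite" and Y :: "'w \<Rightarrow> 'b::finite" and Z :: "'w \<Rightarrow> 'c::finite"
  shows "0 \<le> \<I>\<^bsub>p\<^esub>(X ; Y | Z)"
proof -
  interpret information_space "measure_pmf p" 2
    by (intro information_space.intro measure_pmf.prob_space_axioms information_space_axioms.intro) simp
  show ?thesis unfolding cond_mi_def
    by (intro conditional_mutual_information_nonneg simple_function_finite)
qed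

lemma info_ratio_pos:
  "\<omega> \<in> set_pmf p \<Longrightarrow> 0 < info_ratio p X Y Z (X \<omega>) (Y \<omega>) (Z \<omega>)"
  unfolding info_ratio_def by (intro divide_pos_pos mult_pos_pos pmf_positive) auto

lemma info_ratio_nonneg: "0 \<le> info_ratio p X Y Z x y z"
  unfolding info_ratio_def by simp

lemma pmf_map_eq_expect:
  "finite (set_pmf p) \<Longrightarrow> pmf (map_pmf f p) z = expect p (\<lambda>\<omega>. of_bool (f \<omega> = z))"
  by (simp add: pmf_map expect_prob vimage_def)

text \<open>Sifting: once a joint law is written as nested expectations of indicators, repeated use
  reads off one factor per layer. The marginals below are all computed this way.\<close>

lemma expect_of_bool_eq:
  "expect (p :: 'a::finite pmf) (\<lambda>x. of_bool (x = a) * f x) = pmf p a * f a"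
proof -
  have "pmf p x * (of_bool (x = a) * f x) = (if x = a then pmf p a * f a else 0)" for x by simp
  thus ?thesis by (simp only: expect_UNIV) simp
qed

lemma sum_pmf_map_pair:
  fixes p :: "'w pmf" and X :: "'w \<Rightarrow> 'a::finite"
  shows "(\<Sum>x\<in>UNIV. pmf (map_pmf (\<lambda>\<omega>. (X \<omega>, Y \<omega>)) p) (x, y)) = pmf (map_pmf Y p) y"
proof -
  have "(\<Sum>x\<in>UNIV. pmf (map_pmf (\<lambda>\<omega>. (X \<omega>, Y \<omega>)) p) (x, y))
     = (\<Sum>z\<in>(\<lambda>x. (x, y)) ` UNIV. pmf (map_pmf (\<lambda>\<omega>. (X \<omega>, Y \<omega>)) p) z)"
    by (subst sum.reindex) (auto simp: inj_on_def)
  also have "\<dots> = measure_pmf.prob (map_pmf (\<lambda>\<omega>. (X \<omega>, Y \<omega>)) p) ((\<lambda>x. (x, y)) ` UNIV)"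
    by (rule measure_measure_pmf_finite[symmetric]) auto
  also have "\<dots> = pmf (map_pmf Y p) y"
    by (auto simp: pmf_map intro!: arg_cong[where f="measure_pmf.prob p"])
  finally show ?thesis .
qed

text \<open>The average of \<open>p(x | y, z) / p(x | z)\<close> against \<open>p(x | z)\<close> is
  the sum of \<open>p(x | y, z)\<close>; terms with a zero denominator can only drop out.\<close>

lemma expect_info_ratio_le:
  fixes X :: "'w \<Rightarrow> 'a::finite" and P :: "'w pmf"
  assumes "\<And>x. pmf (map_pmf (\<lambda>\<omega>. (X \<omega>, Z \<omega>)) P) (x, z) = pmf (map_pmf Z P) z * pmf Q x"
  shows "expect Q (\<lambda>x. info_ratio P X Y Z x y z) \<le> 1"
proof -
  let ?yz = "pmf (map_pmf (\<lambda>\<omega>. (Y \<omega>, Z \<omega>)) P) (y, z)"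
  have "expect Q (\<lambda>x. info_ratio P X Y Z x y z) \<le>
    (\<Sum>x\<in>UNIV. pmf (map_pmf (\<lambda>\<omega>. (X \<omega>, Y \<omega>, Z \<omega>)) P) (x, y, z) / ?yz)"
    unfolding expect_UNIV info_ratio_def assms
    by (intro sum_mono) (auto simp: field_simps)
  also have "\<dots> = (\<Sum>x\<in>UNIV. pmf (map_pmf (\<lambda>\<omega>. (X \<omega>, (Y \<omega>, Z \<omega>))) P) (x, (y, z))) / ?yz"
    by (simp add: sum_divide_distrib)
  also have "\<dots> \<le> 1" unfolding sum_pmf_map_pair by simp
  finally show ?thesis .
qed

text \<open>Logarithms turn the product into an i.i.d. sum, and Chebyshev's inequality applies. The
  constant is the variance divided by \<open>\<delta>\<^sup>2\<close>, the same for all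
  \<open>n\<close> and \<open>B\<close>. Positivity of \<open>f\<close> on the support suffices
  because the events are compared almost surely.\<close>

lemma prob_Pi_prod_le:
  fixes P :: "'w::finite pmf" and f :: "'w \<Rightarrow> real" and \<mu> \<delta> :: real
  assumes "\<And>\<omega>. \<omega> \<in> set_pmf P \<Longrightarrow> 0 < f \<omega>" "\<delta> > 0" and \<mu>: "\<mu> = expect P (\<lambda>\<omega>. log 2 (f \<omega>))"
  obtains c where "\<And>n B. 0 < n \<Longrightarrow> 2 powr (real n * (\<mu> + \<delta>)) \<le> B \<Longrightarrow>
     measure_pmf.prob (Pi_pmf {1..n} d (\<lambda>_. P)) {\<omega>. \<not> (\<Prod>i=1..n. f (\<omega> i)) \<le> B} \<le> c / n"
proof -
  define g where "g \<omega> = log 2 (f \<omega>)" for \<omega>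
  define c where "c = expect P (\<lambda>x. (g x - expect P g)\<^sup>2) / \<delta>\<^sup>2"
  have "measure_pmf.prob (Pi_pmf {1..n} d (\<lambda>_. P)) {\<omega>. \<not> (\<Prod>i=1..n. f (\<omega> i)) \<le> B} \<le> c / n"
    if n: "0 < n" and B: "2 powr (real n * (\<mu> + \<delta>)) \<le> B" for n B
  proof -
    let ?P = "Pi_pmf {1..n} d (\<lambda>_. P)"
    have "measure_pmf.prob ?P {\<omega>. \<not> (\<Prod>i=1..n. f (\<omega> i)) \<le> B}
      \<le> measure_pmf.prob ?P {\<omega>. (\<Sum>i=1..n. g (\<omega> i)) \<ge> real n * (expect P g + \<delta>)}"
    proof (rule measure_pmf.finite_measure_mono_AE)
      show "AE \<omega> in measure_pmf ?P. \<omega> \<in> {\<omega>. \<not> (\<Prod>i=1..n. f (\<omega> i)) \<le> B} \<longrightarrow>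
          \<omega> \<in> {\<omega>. (\<Sum>i=1..n. g (\<omega> i)) \<ge> real n * (expect P g + \<delta>)}"
        unfolding AE_measure_pmf_iff
      proof (intro ballI impI)
        fix \<omega> assume \<omega>: "\<omega> \<in> set_pmf ?P" and "\<omega> \<in> {\<omega>. \<not> (\<Prod>i=1..n. f (\<omega> i)) \<le> B}"
        hence gt: "2 powr (real n * (\<mu> + \<delta>)) < (\<Prod>i=1..n. f (\<omega> i))" using B by auto
        have pos: "0 < f (\<omega> i)" if "i \<in> {1..n}" for i
          using \<omega> that assms(1) by (auto simp: set_Pi_pmf PiE_dflt_def)
        have "(\<Prod>i=1..n. f (\<omega> i)) = (\<Prod>i=1..n. 2 powr g (\<omega> i))"
          by (intro prod.cong) (auto simp: g_def pos)
        also have "\<dots> = 2 powr (\<Sum>i=1..n. g (\<omega> i))" by (simp add: powr_sum)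
        finally show "\<omega> \<in> {\<omega>. (\<Sum>i=1..n. g (\<omega> i)) \<ge> real n * (expect P g + \<delta>)}"
          using gt \<mu> by (simp add: g_def[abs_def])
      qed
    qed auto
    also have "\<dots> \<le> c / n"
      using Pi_pmf_chebyshev[OF n assms(2), of d P g] by (simp add: c_def mult.commute)
    finally show ?thesis .
  qed
  thus ?thesis by (rule that)
qed

locale z_channel =
  fixes pS :: "('s::finite) pmf"
    and W1 :: "('x1::finite) \<Rightarrow> 's \<Rightarrow> ('y1::finite) pmf"
    and W2 :: "'x1 \<Rightarrow> ('x2::finite) \<Rightarrow> 's \<Rightarrow> ('y2::finite) pmf"
    and pQ :: "('q::finite) pmf"
    and pUV :: "'s \<Rightarrow> 'q \<Rightarrow> (('u::finite) \<times> ('v::finite)) pmf"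
    and pX1 :: "'u \<Rightarrow> 'v \<Rightarrow> 's \<Rightarrow> 'q \<Rightarrow> 'x1 pmf"
    and pX2 :: "'q \<Rightarrow> 'x2 pmf"
begin

definition "P = single_letter_pmf pS W1 W2 pQ pUV pX1 pX2"

text \<open>Conditional laws given \<open>Q = q\<close>. The state is drawn from its unconditional
  law because it is independent of \<open>Q\<close>.\<close>

definition pU :: "'q \<Rightarrow> 'u pmf" where "pU q = bind_pmf pS (\<lambda>s. map_pmf fst (pUV s q))"
definition pV :: "'q \<Rightarrow> 'v pmf" where "pV q = bind_pmf pS (\<lambda>s. map_pmf snd (pUV s q))"

definition enc_ratio :: "'q \<Rightarrow> 's \<Rightarrow> 'u \<Rightarrow> 'v \<Rightarrow> real" where
  "enc_ratio q s u v = pmf (pUV s q) (u, v) / (pmf (pU q) u * pmf (pV q) v)"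
definition enc_ratio_U :: "'q \<Rightarrow> 's \<Rightarrow> 'u \<Rightarrow> real" where
  "enc_ratio_U q s u = pmf (map_pmf fst (pUV s q)) u / pmf (pU q) u"
definition enc_ratio_V :: "'q \<Rightarrow> 's \<Rightarrow> 'v \<Rightarrow> real" where
  "enc_ratio_V q s v = pmf (map_pmf snd (pUV s q)) v / pmf (pV q) v"
definition dec_ratio1 :: "'q \<Rightarrow> 'u \<Rightarrow> 'y1 \<Rightarrow> real" where
  "dec_ratio1 q u y = info_ratio P rvU rvY1 rvQ u y q"
definition dec_ratio2 :: "'q \<Rightarrow> 'v \<Rightarrow> 'x2 \<Rightarrow> 'y2 \<Rightarrow> real" where
  "dec_ratio2 q v x y = info_ratio P (rvV \<^bold>, rvX2) rvY2 rvQ (v, x) y q"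
definition dec_ratio2_V :: "'q \<Rightarrow> 'v \<Rightarrow> 'y2 \<Rightarrow> real" where
  "dec_ratio2_V q v y = info_ratio P rvV rvY2 rvQ v y q"

lemma ratio_nonneg:
  "0 \<le> enc_ratio q s u v" "0 \<le> enc_ratio_U q s u" "0 \<le> enc_ratio_V q s v"
  "0 \<le> dec_ratio1 q u y1" "0 \<le> dec_ratio2 q v x y2" "0 \<le> dec_ratio2_V q v y2"
  by (simp_all add: enc_ratio_def enc_ratio_U_def enc_ratio_V_def dec_ratio1_def dec_ratio2_def
     dec_ratio2_V_def info_ratio_nonneg)

section \<open>Marginals of the single-letter law\<close>

lemma expect_P:
  "expect P f = expect pS (\<lambda>s. expect pQ (\<lambda>q. expect (pUV s q) (\<lambda>uv. expect (pX1 (fst uv) (snd uv) s q)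
     (\<lambda>x1. expect (pX2 q) (\<lambda>x2. expect (W1 x1 s) (\<lambda>y1. expect (W2 x1 x2 s) (\<lambda>y2.
       f (s, q, fst uv, snd uv, x1, x2, y1, y2))))))))"
  unfolding P_def single_letter_pmf_def by (simp add: expect_bind case_prod_unfold)

lemma pmf_SQUV: "pmf (map_pmf (\<lambda>\<omega>. (rvS \<omega>, rvQ \<omega>, rvU \<omega>, rvV \<omega>)) P) (s, q, u, v) = pmf pS s * (pmf pQ q * pmf (pUV s q) (u, v))"
proof -
  have "pmf (map_pmf (\<lambda>\<omega>. (rvS \<omega>, rvQ \<omega>, rvU \<omega>, rvV \<omega>)) P) (s, q, u, v) =
    expect pS (\<lambda>s'. of_bool (s' = s) * expect pQ (\<lambda>q'. of_bool (q' = q) * expect (pUV s' q') (\<lambda>uv. of_bool (uv = (u, v)) * 1)))"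
    by (simp add: pmf_map_eq_expect expect_P prod_eq_iff of_bool_conj expect_cmult)
  thus ?thesis unfolding expect_of_bool_eq by simp
qed

lemma pmf_QVX: "pmf (map_pmf (\<lambda>\<omega>. (rvQ \<omega>, rvV \<omega>, rvX2 \<omega>)) P) (q, v, x) = pmf pQ q * (pmf (pV q) v * pmf (pX2 q) x)"
proof -
  have "pmf (map_pmf (\<lambda>\<omega>. (rvQ \<omega>, rvV \<omega>, rvX2 \<omega>)) P) (q, v, x) =
    expect pQ (\<lambda>q'. of_bool (q' = q) * expect pS (\<lambda>s. expect (pUV s q') (\<lambda>uv. of_bool (snd uv = v)) * expect (pX2 q') (\<lambda>x'. of_bool (x' = x) * 1)))"
    by (simp add: pmf_map_eq_expect expect_P of_bool_conj expect_cmult expect_multc expect_swap[of pS pQ])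
  thus ?thesis unfolding expect_of_bool_eq
    by (simp add: expect_multc pV_def pmf_map_eq_expect expect_bind pmf_bind expect_eq_integral)
qed

lemma pmf_UQ: "pmf (map_pmf (\<lambda>\<omega>. (rvU \<omega>, rvQ \<omega>)) P) (u, q) = pmf pQ q * pmf (pU q) u"
proof -
  have "pmf (map_pmf (\<lambda>\<omega>. (rvU \<omega>, rvQ \<omega>)) P) (u, q) =
    expect pQ (\<lambda>q'. of_bool (q' = q) * expect pS (\<lambda>s. expect (pUV s q') (\<lambda>uv. of_bool (fst uv = u))))"
    by (simp add: pmf_map_eq_expect expect_P of_bool_conj expect_cmult expect_multc expect_swap[of pS pQ] mult.commute)
  thus ?thesis unfolding expect_of_bool_eq
    by (simp add: pU_def pmf_map_eq_expect expect_bind pmf_bind expect_eq_integral)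
qed

lemma pmf_VQ: "pmf (map_pmf (\<lambda>\<omega>. (rvV \<omega>, rvQ \<omega>)) P) (v, q) = pmf pQ q * pmf (pV q) v"
proof -
  have "pmf (map_pmf (\<lambda>\<omega>. (rvV \<omega>, rvQ \<omega>)) P) (v, q) =
    expect pQ (\<lambda>q'. of_bool (q' = q) * expect pS (\<lambda>s. expect (pUV s q') (\<lambda>uv. of_bool (snd uv = v))))"
    by (simp add: pmf_map_eq_expect expect_P of_bool_conj expect_cmult expect_multc expect_swap[of pS pQ] mult.commute)
  thus ?thesis unfolding expect_of_bool_eq
    by (simp add: pV_def pmf_map_eq_expect expect_bind pmf_bind expect_eq_integral)
qed

lemma pmf_Q: "pmf (map_pmf rvQ P) q = pmf pQ q"
proof -
  have "pmf (map_pmf rvQ P) q = expect pQ (\<lambda>q'. of_bool (q' = q) * 1)"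
    by (simp add: pmf_map_eq_expect expect_P)
  thus ?thesis unfolding expect_of_bool_eq by simp
qed

lemma pmf_SQ: "pmf (map_pmf (\<lambda>\<omega>. (rvS \<omega>, rvQ \<omega>)) P) (s, q) = pmf pS s * pmf pQ q"
proof -
  have "pmf (map_pmf (\<lambda>\<omega>. (rvS \<omega>, rvQ \<omega>)) P) (s, q) = 
    expect pS (\<lambda>s'. of_bool (s' = s) * expect pQ (\<lambda>q'. of_bool (q' = q) * 1))"
    by (simp add: pmf_map_eq_expect expect_P of_bool_conj expect_cmult)
  thus ?thesis unfolding expect_of_bool_eq by simp
qed

lemma pmf_USQ: "pmf (map_pmf (\<lambda>\<omega>. (rvU \<omega>, rvS \<omega>, rvQ \<omega>)) P) (u, s, q) = pmf pS s * (pmf pQ q * pmf (map_pmf fst (pUV s q)) u)"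
proof -
  have "pmf (map_pmf (\<lambda>\<omega>. (rvU \<omega>, rvS \<omega>, rvQ \<omega>)) P) (u, s, q) =
    expect P (\<lambda>\<omega>. of_bool (rvS \<omega> = s) * (of_bool (rvQ \<omega> = q) * of_bool (rvU \<omega> = u)))"
    by (simp add: pmf_map_eq_expect of_bool_conj mult_ac)
  also have "\<dots> = expect pS (\<lambda>s'. of_bool (s' = s) * expect pQ (\<lambda>q'. of_bool (q' = q) * expect (pUV s' q') (\<lambda>uv. of_bool (fst uv = u))))"
    by (simp add: expect_P expect_cmult)
  finally show ?thesis unfolding expect_of_bool_eq by (simp add: pmf_map_eq_expect)
qed

lemma pmf_VSQ: "pmf (map_pmf (\<lambda>\<omega>. (rvV \<omega>, rvS \<omega>, rvQ \<omega>)) P) (v, s, q) = pmf pS s * (pmf pQ q * pmf (map_pmf snd (pUV s q)) v)"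
proof -
  have "pmf (map_pmf (\<lambda>\<omega>. (rvV \<omega>, rvS \<omega>, rvQ \<omega>)) P) (v, s, q) =
    expect P (\<lambda>\<omega>. of_bool (rvS \<omega> = s) * (of_bool (rvQ \<omega> = q) * of_bool (rvV \<omega> = v)))"
    by (simp add: pmf_map_eq_expect of_bool_conj mult_ac)
  also have "\<dots> = expect pS (\<lambda>s'. of_bool (s' = s) * expect pQ (\<lambda>q'. of_bool (q' = q) * expect (pUV s' q') (\<lambda>uv. of_bool (snd uv = v))))"
    by (simp add: expect_P expect_cmult)
  finally show ?thesis unfolding expect_of_bool_eq by (simp add: pmf_map_eq_expect)
qed

section \<open>Ratios as information densities, with their chain rules\<close>

lemma enc_ratio_U_eq:
  assumes "s \<in> set_pmf pS" "q \<in> set_pmf pQ"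
  shows "enc_ratio_U q s u = info_ratio P rvU rvS rvQ u s q"
  using pmf_positive[OF assms(1)] pmf_positive[OF assms(2)]
  by (simp add: enc_ratio_U_def info_ratio_def pmf_UQ pmf_SQ pmf_USQ pmf_Q)

lemma enc_ratio_V_eq:
  assumes "s \<in> set_pmf pS" "q \<in> set_pmf pQ"
  shows "enc_ratio_V q s v = info_ratio P rvV rvS rvQ v s q"
  using pmf_positive[OF assms(1)] pmf_positive[OF assms(2)]
  by (simp add: enc_ratio_V_def info_ratio_def pmf_VQ pmf_SQ pmf_VSQ pmf_Q)

text \<open>Chain rule: \<open>p(u, v | s, q)\<close> factors as
  \<open>p(u | s, q) p(v | u, s, q)\<close>. In the mean logarithm this produces
  \<open>I(U; S | Q) + I(U, S; V | Q)\<close>, the terms subtracted in the sum-rate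
  condition.\<close>

lemma enc_ratio_eq:
  assumes "s \<in> set_pmf pS" "q \<in> set_pmf pQ" "u \<in> set_pmf (map_pmf fst (pUV s q))"
  shows "enc_ratio q s u v = enc_ratio_U q s u * info_ratio P (rvU \<^bold>, rvS) rvV rvQ (u, s) v q"
proof -
  \<comment> \<open>The same joint law appears with its components in another order; an injective
    relabeling carries the probabilities over.\<close>
  have "inj (\<lambda>(s, q, u, v). ((u, s), v, q))" by (auto simp: inj_def)
  from pmf_map_inj'[OF this, of "map_pmf (\<lambda>\<omega>. (rvS \<omega>, rvQ \<omega>, rvU \<omega>, rvV \<omega>)) P" "(s, q, u, v)"]
  have 1: "pmf (map_pmf (\<lambda>\<omega>. ((rvU \<omega>, rvS \<omega>), rvV \<omega>, rvQ \<omega>)) P) ((u, s), v, q) = pmf pS s * (pmf pQ q * pmf (pUV s q) (u, v))"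
    by (simp add: pmf.map_comp o_def pmf_SQUV)
  have "inj (\<lambda>(u, s, q). ((u, s), q))" by (auto simp: inj_def)
  from pmf_map_inj'[OF this, of "map_pmf (\<lambda>\<omega>. (rvU \<omega>, rvS \<omega>, rvQ \<omega>)) P" "(u, s, q)"]
  have 2: "pmf (map_pmf (\<lambda>\<omega>. ((rvU \<omega>, rvS \<omega>), rvQ \<omega>)) P) ((u, s), q) = pmf pS s * (pmf pQ q * pmf (map_pmf fst (pUV s q)) u)"
    by (simp add: pmf.map_comp o_def pmf_USQ)
  show ?thesis
    using assms[THEN pmf_positive]
    by (simp add: enc_ratio_def enc_ratio_U_def info_ratio_def pair_rv_def 1 2 pmf_VQ pmf_Q)
qed

lemma pmf_VX_Q: "pmf (map_pmf (\<lambda>\<omega>. ((rvV \<^bold>, rvX2) \<omega>, rvQ \<omega>)) P) ((v, x), q) = pmf pQ q * pmf (pair_pmf (pV q) (pX2 q)) (v, x)"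
proof -
  have "inj (\<lambda>(q, v, x). ((v, x), q))" by (auto simp: inj_def)
  from pmf_map_inj'[OF this, of "map_pmf (\<lambda>\<omega>. (rvQ \<omega>, rvV \<omega>, rvX2 \<omega>)) P" "(q, v, x)"]
  show ?thesis by (simp add: pmf.map_comp o_def pmf_QVX pair_rv_def pmf_pair)
qed

text \<open>Pointwise form of \<open>I(V, X2; Y2 | Q) = I(V; Y2 | Q) + I(X2; Y2 | V, Q)\<close>. The
  quotient of the two decoding ratios is thus governed by \<open>I(X2; Y2 | V, Q)\<close>, which
  limits \<open>R2\<close> when competitors share \<open>v\<close>.\<close>

lemma dec_ratio2_eq:
  assumes "\<omega> \<in> set_pmf P"
  shows "dec_ratio2 (rvQ \<omega>) (rvV \<omega>) (rvX2 \<omega>) (rvY2 \<omega>) =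
    dec_ratio2_V (rvQ \<omega>) (rvV \<omega>) (rvY2 \<omega>) * info_ratio P rvX2 rvY2 (rvV \<^bold>, rvQ) (rvX2 \<omega>) (rvY2 \<omega>) (rvV \<omega>, rvQ \<omega>)"
proof -
  obtain q v x y where \<omega>: "q = rvQ \<omega>" "v = rvV \<omega>" "x = rvX2 \<omega>" "y = rvY2 \<omega>" by blast
  have "inj (\<lambda>((v, x), y, q). (x, y, v, q))" by (auto simp: inj_def)
  from pmf_map_inj'[OF this, of "map_pmf (\<lambda>\<omega>. ((rvV \<omega>, rvX2 \<omega>), rvY2 \<omega>, rvQ \<omega>)) P" "((v, x), y, q)"]
  have 1: "pmf (map_pmf (\<lambda>\<omega>. ((rvV \<omega>, rvX2 \<omega>), rvY2 \<omega>, rvQ \<omega>)) P) ((v, x), y, q) =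
      pmf (map_pmf (\<lambda>\<omega>. (rvX2 \<omega>, rvY2 \<omega>, rvV \<omega>, rvQ \<omega>)) P) (x, y, v, q)"
    by (simp add: pmf.map_comp o_def)
  have "inj (\<lambda>((v, x), q). (x, v, q))" by (auto simp: inj_def)
  from pmf_map_inj'[OF this, of "map_pmf (\<lambda>\<omega>. ((rvV \<omega>, rvX2 \<omega>), rvQ \<omega>)) P" "((v, x), q)"]
  have 2: "pmf (map_pmf (\<lambda>\<omega>. ((rvV \<omega>, rvX2 \<omega>), rvQ \<omega>)) P) ((v, x), q) =
      pmf (map_pmf (\<lambda>\<omega>. (rvX2 \<omega>, rvV \<omega>, rvQ \<omega>)) P) (x, v, q)"
    by (simp add: pmf.map_comp o_def)
  have "inj (\<lambda>(v, y, q). (y, v, q))" by (auto simp: inj_def)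
  from pmf_map_inj'[OF this, of "map_pmf (\<lambda>\<omega>. (rvV \<omega>, rvY2 \<omega>, rvQ \<omega>)) P" "(v, y, q)"]
  have 3: "pmf (map_pmf (\<lambda>\<omega>. (rvV \<omega>, rvY2 \<omega>, rvQ \<omega>)) P) (v, y, q) =
      pmf (map_pmf (\<lambda>\<omega>. (rvY2 \<omega>, rvV \<omega>, rvQ \<omega>)) P) (y, v, q)"
    by (simp add: pmf.map_comp o_def)
  have "0 < pmf (map_pmf (\<lambda>\<omega>. (rvY2 \<omega>, rvV \<omega>, rvQ \<omega>)) P) (y, v, q)"
       "0 < pmf (map_pmf (\<lambda>\<omega>. (rvV \<omega>, rvQ \<omega>)) P) (v, q)"
    using assms \<omega> by (auto intro!: pmf_positive)
  thus ?thesis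
    by (simp add: dec_ratio2_def dec_ratio2_V_def info_ratio_def pair_rv_def 1 2 3 mult_ac flip: \<omega>)
qed

text \<open>The change of measure survives division by zero: for \<open>s\<close> in the support, a
  pair of positive conditional probability has components of positive probability under the averaged
  laws.\<close>

lemma enc_ratio_mult:
  assumes "s \<in> set_pmf pS"
  shows "pmf (pU q) u * (pmf (pV q) v * enc_ratio q s u v) = pmf (pUV s q) (u, v)"
proof (cases "(u, v) \<in> set_pmf (pUV s q)")
  case True
  hence "u \<in> set_pmf (pU q)" "v \<in> set_pmf (pV q)" using assms by (force simp: pU_def pV_def)+
  thus ?thesis by (simp add: enc_ratio_def pmf_eq_0_set_pmf)
next
  case False
  thus ?thesis by (simp add: enc_ratio_def pmf_eq_0_set_pmf)
qed

section \<open>Normalization of the ratios under the codebook laws\<close>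

lemma expect_enc_ratio_V: "expect (pU q) (\<lambda>u. enc_ratio q s u v) \<le> enc_ratio_V q s v"
proof -
  \<comment> \<open>The factor \<open>p(u | q)\<close> cancels unless it is zero, in which case the
    left-hand side vanishes; hence only an inequality.\<close>
  have "pmf (pU q) u * enc_ratio q s u v \<le> pmf (pUV s q) (u, v) / pmf (pV q) v" for u
    by (cases "pmf (pU q) u = 0") (auto simp: enc_ratio_def)
  hence "expect (pU q) (\<lambda>u. enc_ratio q s u v) \<le> (\<Sum>u\<in>UNIV. pmf (pUV s q) (u, v) / pmf (pV q) v)"
    unfolding expect_UNIV by (intro sum_mono)
  also have "\<dots> = enc_ratio_V q s v"
    using sum_pmf_map_pair[of fst snd "pUV s q" v]
    by (simp add: enc_ratio_V_def sum_divide_distrib[symmetric] pmf.map_ident)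
  finally show ?thesis .
qed

lemma expect_enc_ratio_U: "expect (pV q) (\<lambda>v. enc_ratio q s u v) \<le> enc_ratio_U q s u"
proof -
  have "pmf (pV q) v * enc_ratio q s u v \<le> pmf (map_pmf (\<lambda>\<omega>. (snd \<omega>, fst \<omega>)) (pUV s q)) (v, u) / pmf (pU q) u" for v
  proof -
    have "inj (\<lambda>\<omega>::'u \<times> 'v. (snd \<omega>, fst \<omega>))" by (auto simp: inj_def)
    from pmf_map_inj'[OF this, of "pUV s q" "(u, v)"] show ?thesis
      by (cases "pmf (pV q) v = 0") (auto simp: enc_ratio_def)
  qed
  hence "expect (pV q) (\<lambda>v. enc_ratio q s u v) \<le> (\<Sum>v\<in>UNIV. pmf (map_pmf (\<lambda>\<omega>. (snd \<omega>, fst \<omega>)) (pUV s q)) (v, u) / pmf (pU q) u)"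
    unfolding expect_UNIV by (intro sum_mono)
  also have "\<dots> = enc_ratio_U q s u"
    by (simp add: enc_ratio_U_def sum_divide_distrib[symmetric] sum_pmf_map_pair)
  finally show ?thesis .
qed

lemma expect_enc_ratio: "expect (pU q) (\<lambda>u. expect (pV q) (\<lambda>v. enc_ratio q s u v)) \<le> 1"
proof -
  have "expect (pU q) (\<lambda>u. expect (pV q) (\<lambda>v. enc_ratio q s u v)) \<le> expect (pU q) (\<lambda>u. enc_ratio_U q s u)"
    by (intro expect_mono expect_enc_ratio_U)
  also have "\<dots> \<le> (\<Sum>u\<in>UNIV. pmf (map_pmf fst (pUV s q)) u)"
    unfolding expect_UNIV enc_ratio_U_def by (intro sum_mono) auto
  also have "\<dots> = 1" by (rule sum_pmf_eq_1) auto
  finally show ?thesis .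
qed

lemma expect_dec_ratio1: "expect (pU q) (\<lambda>u. dec_ratio1 q u y) \<le> 1"
  unfolding dec_ratio1_def by (intro expect_info_ratio_le) (simp add: pmf_UQ pmf_Q)

lemma expect_dec_ratio2: "expect (pV q) (\<lambda>v. expect (pX2 q) (\<lambda>x. dec_ratio2 q v x y)) \<le> 1"
proof -
  have "expect (pair_pmf (pV q) (pX2 q)) (\<lambda>vx. info_ratio P (rvV \<^bold>, rvX2) rvY2 rvQ vx y q) \<le> 1"
    by (intro expect_info_ratio_le) (auto simp: pmf_VX_Q pmf_Q simp flip: pmf_pair)
  thus ?thesis by (simp add: expect_pair dec_ratio2_def)
qed

text \<open>\<open>V\<close> and \<open>X2\<close> are independent given \<open>Q\<close>, so
  averaging over \<open>X2\<close> cancels \<open>p(x2 | q)\<close> and sums \<open>x2\<close> out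
  of the joint law.\<close>

lemma expect_dec_ratio2_V: "expect (pX2 q) (\<lambda>x. dec_ratio2 q v x y) \<le> dec_ratio2_V q v y"
proof -
  let ?p = "\<lambda>x. pmf (map_pmf (\<lambda>\<omega>. (rvX2 \<omega>, (rvV \<omega>, rvY2 \<omega>, rvQ \<omega>))) P) (x, (v, y, q))"
  let ?c = "pmf (map_pmf (\<lambda>\<omega>. (rvV \<omega>, rvQ \<omega>)) P) (v, q) * (pmf (map_pmf (\<lambda>\<omega>. (rvY2 \<omega>, rvQ \<omega>)) P) (y, q) / pmf (map_pmf rvQ P) q)"
  have "pmf (pX2 q) x * dec_ratio2 q v x y \<le> ?p x / ?c" for x
  proof -
    have "inj (\<lambda>(x, v, y, q). ((v, x), y, q))" by (auto simp: inj_def)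
    from pmf_map_inj'[OF this, of "map_pmf (\<lambda>\<omega>. (rvX2 \<omega>, rvV \<omega>, rvY2 \<omega>, rvQ \<omega>)) P" "(x, v, y, q)"]
    have "pmf (map_pmf (\<lambda>\<omega>. ((rvV \<omega>, rvX2 \<omega>), rvY2 \<omega>, rvQ \<omega>)) P) ((v, x), y, q) = ?p x"
      by (simp add: pmf.map_comp o_def)
    thus ?thesis using pmf_VX_Q[of v x q]
      by (cases "pmf (pX2 q) x = 0") (auto simp: dec_ratio2_def info_ratio_def pmf_VQ pair_rv_def pmf_pair)
  qed
  hence "expect (pX2 q) (\<lambda>x. dec_ratio2 q v x y) \<le> (\<Sum>x\<in>UNIV. ?p x / ?c)"
    unfolding expect_UNIV by (intro sum_mono)
  also have "\<dots> = dec_ratio2_V q v y"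
    unfolding sum_divide_distrib[symmetric] sum_pmf_map_pair by (simp add: dec_ratio2_V_def info_ratio_def)
  finally show ?thesis .
qed

end

section \<open>Block laws\<close>

lemma finite_set_Pi_pmf_finite [simp]:
  fixes p :: "'i \<Rightarrow> 'a::finite pmf"
  shows "finite A \<Longrightarrow> finite (set_pmf (Pi_pmf A d p))"
  by auto

context z_channel
begin

text \<open>The joint law in which \<open>U\<close> and \<open>V\<close> are drawn independently of each other and of the
  state, as the codewords are.\<close>
definition indep_pmf :: "('s \<times> 'q \<times> 'u \<times> 'v \<times> 'x1 \<times> 'x2 \<times> 'y1 \<times> 'y2) pmf" where
  "indep_pmf = do {
     q \<leftarrow> pQ;
     s \<leftarrow> pS;
     u \<leftarrow> pU q;
     v \<leftarrow> pV q;
     x2 \<leftarrow> pX2 q;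
     x1 \<leftarrow> pX1 u v s q;
     y1 \<leftarrow> W1 x1 s;
     y2 \<leftarrow> W2 x1 x2 s;
     return_pmf (s, q, u, v, x1, x2, y1, y2)
   }"

section \<open>Change of measure from independent codewords to the joint law\<close>

lemma pmf_P:
  "pmf P (s, q, u, v, x1, x2, y1, y2) = pmf pS s * (pmf pQ q * (pmf (pUV s q) (u, v) *
     (pmf (pX1 u v s q) x1 * (pmf (pX2 q) x2 * (pmf (W1 x1 s) y1 * pmf (W2 x1 x2 s) y2)))))"
proof -
  have "pmf P (s, q, u, v, x1, x2, y1, y2) = pmf (map_pmf (\<lambda>\<omega>. \<omega>) P) (s, q, u, v, x1, x2, y1, y2)"
    by simp
  also have "\<dots> = expect pS (\<lambda>s'. of_bool (s' = s) * expect pQ (\<lambda>q'. of_bool (q' = q) *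
     expect (pUV s' q') (\<lambda>uv. of_bool (uv = (u, v)) * expect (pX1 (fst uv) (snd uv) s' q') (\<lambda>x1'. of_bool (x1' = x1) *
     expect (pX2 q') (\<lambda>x2'. of_bool (x2' = x2) * expect (W1 x1' s') (\<lambda>y1'. of_bool (y1' = y1) *
     expect (W2 x1' x2' s') (\<lambda>y2'. of_bool (y2' = y2) * 1)))))))"
    by (subst pmf_map_eq_expect) (simp_all add: expect_P prod_eq_iff of_bool_conj expect_cmult mult.assoc)
  finally show ?thesis unfolding expect_of_bool_eq by simp
qed

lemma pmf_indep:
  "pmf indep_pmf (s, q, u, v, x1, x2, y1, y2) = pmf pQ q * (pmf pS s * (pmf (pU q) u * (pmf (pV q) v *
     (pmf (pX2 q) x2 * (pmf (pX1 u v s q) x1 * (pmf (W1 x1 s) y1 * pmf (W2 x1 x2 s) y2))))))"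
proof -
  have "pmf indep_pmf (s, q, u, v, x1, x2, y1, y2) = pmf (map_pmf (\<lambda>(s, q, u, v, x1, x2, y1, y2). (q, s, u, v, x2, x1, y1, y2)) indep_pmf) (q, s, u, v, x2, x1, y1, y2)"
    using pmf_map_inj'[of "\<lambda>(s, q, u, v, x1, x2, y1, y2). (q, s, u, v, x2, x1, y1, y2)" indep_pmf "(s, q, u, v, x1, x2, y1, y2)"]
    by (simp add: inj_def)
  also have "\<dots> = expect pQ (\<lambda>q'. of_bool (q' = q) * expect pS (\<lambda>s'. of_bool (s' = s) *
     expect (pU q') (\<lambda>u'. of_bool (u' = u) * expect (pV q') (\<lambda>v'. of_bool (v' = v) *
     expect (pX2 q') (\<lambda>x2'. of_bool (x2' = x2) * expect (pX1 u' v' s' q') (\<lambda>x1'. of_bool (x1' = x1) *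
     expect (W1 x1' s') (\<lambda>y1'. of_bool (y1' = y1) * expect (W2 x1' x2' s') (\<lambda>y2'. of_bool (y2' = y2) * 1))))))))"
    by (simp add: pmf_map_eq_expect indep_pmf_def expect_bind of_bool_conj expect_cmult)
  finally show ?thesis unfolding expect_of_bool_eq by simp
qed

definition weight :: "'s \<times> 'q \<times> 'u \<times> 'v \<times> 'x1 \<times> 'x2 \<times> 'y1 \<times> 'y2 \<Rightarrow> real" where
  "weight \<omega> = enc_ratio (rvQ \<omega>) (rvS \<omega>) (rvU \<omega>) (rvV \<omega>)"

lemma pmf_P_eq_indep: "pmf P \<omega> = pmf indep_pmf \<omega> * weight \<omega>"
proof -
  obtain s q u v x1 x2 y1 y2 where \<omega>: "\<omega> = (s, q, u, v, x1, x2, y1, y2)" by (metis surj_pair)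
  show ?thesis
  proof (cases "s \<in> set_pmf pS")
    case True
    show ?thesis unfolding \<omega> pmf_P pmf_indep enc_ratio_mult[OF True, symmetric]
      by (simp add: weight_def mult_ac)
  next
    case False
    thus ?thesis by (simp add: \<omega> pmf_P pmf_indep pmf_eq_0_set_pmf)
  qed
qed

lemma expect_Pi_P:
  fixes n :: nat
  shows "expect (Pi_pmf {1..n} d (\<lambda>_. P)) \<phi> =
    expect (Pi_pmf {1..n} d (\<lambda>_. indep_pmf)) (\<lambda>\<omega>. (\<Prod>i=1..n. weight (\<omega> i)) * \<phi> \<omega>)"
proof -
  \<comment> \<open>The two product laws may have different supports, so both expectations are
    expanded over all sequences.\<close>
  have fin: "finite (PiE_dflt {1..n} d (\<lambda>_. UNIV :: ('s \<times> 'q \<times> 'u \<times> 'v \<times> 'x1 \<times> 'x2 \<times> 'y1 \<times> 'y2) set))"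
    by (intro finite_PiE_dflt) auto
  have sub: "set_pmf (Pi_pmf {1..n} d (\<lambda>_. p)) \<subseteq> PiE_dflt {1..n} d (\<lambda>_. UNIV)" for p :: "('s \<times> 'q \<times> 'u \<times> 'v \<times> 'x1 \<times> 'x2 \<times> 'y1 \<times> 'y2) pmf"
    by (subst set_Pi_pmf) (auto simp: PiE_dflt_def)
  have "expect (Pi_pmf {1..n} d (\<lambda>_. P)) \<phi> = (\<Sum>\<omega>\<in>PiE_dflt {1..n} d (\<lambda>_. UNIV). pmf (Pi_pmf {1..n} d (\<lambda>_. P)) \<omega> * \<phi> \<omega>)"
    by (rule expect_superset[OF fin sub])
  also have "\<dots> = (\<Sum>\<omega>\<in>PiE_dflt {1..n} d (\<lambda>_. UNIV). pmf (Pi_pmf {1..n} d (\<lambda>_. indep_pmf)) \<omega> * ((\<Prod>i=1..n. weight (\<omega> i)) * \<phi> \<omega>))"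
    by (intro sum.cong refl) (auto simp: pmf_Pi pmf_P_eq_indep prod.distrib)
  also have "\<dots> = expect (Pi_pmf {1..n} d (\<lambda>_. indep_pmf)) (\<lambda>\<omega>. (\<Prod>i=1..n. weight (\<omega> i)) * \<phi> \<omega>)"
    by (rule expect_superset[OF fin sub, symmetric])
  finally show ?thesis .
qed

text \<open>Each letter is drawn conditionally on letters at the same position only, so a product of
  chains is a chain of products.\<close>

lemma Pi_indep:
  fixes n :: nat
  shows "Pi_pmf {1..n} undefined (\<lambda>_. indep_pmf) = do {
     q \<leftarrow> Pi_pmf {1..n} undefined (\<lambda>_. pQ);
     s \<leftarrow> Pi_pmf {1..n} undefined (\<lambda>_. pS);
     u \<leftarrow> Pi_pmf {1..n} undefined (\<lambda>i. pU (q i));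
     v \<leftarrow> Pi_pmf {1..n} undefined (\<lambda>i. pV (q i));
     x2 \<leftarrow> Pi_pmf {1..n} undefined (\<lambda>i. pX2 (q i));
     x1 \<leftarrow> Pi_pmf {1..n} undefined (\<lambda>i. pX1 (u i) (v i) (s i) (q i));
     y1 \<leftarrow> Pi_pmf {1..n} undefined (\<lambda>i. W1 (x1 i) (s i));
     y2 \<leftarrow> Pi_pmf {1..n} undefined (\<lambda>i. W2 (x1 i) (x2 i) (s i));
     return_pmf (\<lambda>i. if i \<in> {1..n} then (s i, q i, u i, v i, x1 i, x2 i, y1 i, y2 i) else undefined)
   }"
  unfolding indep_pmf_def
  by (subst Pi_pmf_bind[where d'=undefined], simp, intro bind_pmf_cong refl)+ (simp add: Pi_pmf_return_pmf)

text \<open>Puts the i.i.d. law into the shape of \<open>G1\<close> and \<open>G2\<close>: codewords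
  independent given the time-sharing sequence, reweighted by the encoder's density, with the channel
  input and outputs innermost.\<close>

lemma expect_Pi_P_nested:
  fixes n :: nat
  shows "expect (Pi_pmf {1..n} undefined (\<lambda>_. P)) \<phi> =
    expect (Pi_pmf {1..n} undefined (\<lambda>_. pQ)) (\<lambda>q. expect (Pi_pmf {1..n} undefined (\<lambda>_. pS)) (\<lambda>s.
    expect (Pi_pmf {1..n} undefined (\<lambda>i. pU (q i))) (\<lambda>u. expect (Pi_pmf {1..n} undefined (\<lambda>i. pV (q i))) (\<lambda>v.
    expect (Pi_pmf {1..n} undefined (\<lambda>i. pX2 (q i))) (\<lambda>x2. (\<Prod>i=1..n. enc_ratio (q i) (s i) (u i) (v i)) *
    expect (Pi_pmf {1..n} undefined (\<lambda>i. pX1 (u i) (v i) (s i) (q i))) (\<lambda>x1.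
    expect (Pi_pmf {1..n} undefined (\<lambda>i. W1 (x1 i) (s i))) (\<lambda>y1.
    expect (Pi_pmf {1..n} undefined (\<lambda>i. W2 (x1 i) (x2 i) (s i))) (\<lambda>y2.
    \<phi> (\<lambda>i. if i \<in> {1..n} then (s i, q i, u i, v i, x1 i, x2 i, y1 i, y2 i) else undefined)))))))))"
  unfolding expect_Pi_P Pi_indep
  by (simp add: expect_bind weight_def expect_cmult cong: prod.cong_simp)

end

section \<open>Block codes\<close>

context z_channel
begin

text \<open>Typicality is meant in the weak sense, as thresholds on products of information ratios.
  Here and in the two decoder versions they are exactly the inequalities demanded by
  \<open>one_shot\<close>.\<close>

definition enc_typical :: "nat \<Rightarrow> nat \<Rightarrow> nat \<Rightarrow> real \<Rightarrow> (nat \<Rightarrow> 'q) \<Rightarrow> (nat \<Rightarrow> 's) \<Rightarrow> (nat \<Rightarrow> 'u) \<Rightarrow> (nat \<Rightarrow> 'v) \<Rightarrow> bool" where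
  "enc_typical n L1 L2 \<eta> q s u v \<longleftrightarrow>
     (\<Prod>i=1..n. enc_ratio_U (q i) (s i) (u i)) \<le> \<eta> * L1 \<and>
     (\<Prod>i=1..n. enc_ratio_V (q i) (s i) (v i)) \<le> \<eta> * L2 \<and>
     (\<Prod>i=1..n. enc_ratio (q i) (s i) (u i) (v i)) \<le> \<eta> * (L1 * L2)"

definition dec_typical1 :: "nat \<Rightarrow> nat \<Rightarrow> nat \<Rightarrow> real \<Rightarrow> (nat \<Rightarrow> 'q) \<Rightarrow> (nat \<Rightarrow> 'u) \<Rightarrow> (nat \<Rightarrow> 'y1) \<Rightarrow> bool" where
  "dec_typical1 n M1 L1 \<eta> q u y \<longleftrightarrow> M1 * L1 \<le> \<eta> * (\<Prod>i=1..n. dec_ratio1 (q i) (u i) (y i))"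

definition dec_typical2 :: "nat \<Rightarrow> nat \<Rightarrow> nat \<Rightarrow> real \<Rightarrow> (nat \<Rightarrow> 'q) \<Rightarrow> (nat \<Rightarrow> 'v) \<Rightarrow> (nat \<Rightarrow> 'x2) \<Rightarrow> (nat \<Rightarrow> 'y2) \<Rightarrow> bool" where
  "dec_typical2 n M2 L2 \<eta> q v x y \<longleftrightarrow>
     M2 * (\<Prod>i=1..n. dec_ratio2_V (q i) (v i) (y i)) \<le> \<eta> * (\<Prod>i=1..n. dec_ratio2 (q i) (v i) (x i) (y i)) \<and>
     M2 * L2 \<le> \<eta> * (\<Prod>i=1..n. dec_ratio2 (q i) (v i) (x i) (y i))"

definition "typical1 n M1 L1 L2 \<eta> \<omega> \<longleftrightarrow>
  enc_typical n L1 L2 \<eta> (\<lambda>i. rvQ (\<omega> i)) (\<lambda>i. rvS (\<omega> i)) (\<lambda>i. rvU (\<omega> i)) (\<lambda>i. rvV (\<omega> i)) \<and>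
  dec_typical1 n M1 L1 \<eta> (\<lambda>i. rvQ (\<omega> i)) (\<lambda>i. rvU (\<omega> i)) (\<lambda>i. rvY1 (\<omega> i))"

definition "typical2 n M2 L1 L2 \<eta> \<omega> \<longleftrightarrow>
  enc_typical n L1 L2 \<eta> (\<lambda>i. rvQ (\<omega> i)) (\<lambda>i. rvS (\<omega> i)) (\<lambda>i. rvU (\<omega> i)) (\<lambda>i. rvV (\<omega> i)) \<and>
  dec_typical2 n M2 L2 \<eta> (\<lambda>i. rvQ (\<omega> i)) (\<lambda>i. rvV (\<omega> i)) (\<lambda>i. rvX2 (\<omega> i)) (\<lambda>i. rvY2 (\<omega> i))"

text \<open>For a fixed time-sharing sequence all laws and densities are products over the letters,
  so each normalization condition factors into its single-letter version.\<close>

lemma one_shot_block: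
  fixes q :: "nat \<Rightarrow> 'q"
  assumes "0 < M1" "0 < M2" "0 < L1" "0 < L2" "0 < \<eta>"
  shows "one_shot (Pi_pmf {1..n} undefined (\<lambda>_. pS)) (Pi_pmf {1..n} undefined (\<lambda>i. pU (q i)))
    (Pi_pmf {1..n} undefined (\<lambda>i. pV (q i))) (Pi_pmf {1..n} undefined (\<lambda>i. pX2 (q i)))
    (\<lambda>u v s. Pi_pmf {1..n} undefined (\<lambda>i. pX1 (u i) (v i) (s i) (q i)))
    (\<lambda>x1 s. Pi_pmf {1..n} undefined (\<lambda>i. W1 (x1 i) (s i)))
    (\<lambda>x1 x2 s. Pi_pmf {1..n} undefined (\<lambda>i. W2 (x1 i) (x2 i) (s i)))
    (\<lambda>s u v. \<Prod>i=1..n. enc_ratio (q i) (s i) (u i) (v i))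
    (\<lambda>s u. \<Prod>i=1..n. enc_ratio_U (q i) (s i) (u i))
    (\<lambda>s v. \<Prod>i=1..n. enc_ratio_V (q i) (s i) (v i))
    (\<lambda>u y. \<Prod>i=1..n. dec_ratio1 (q i) (u i) (y i))
    (\<lambda>v x y. \<Prod>i=1..n. dec_ratio2 (q i) (v i) (x i) (y i))
    (\<lambda>v y. \<Prod>i=1..n. dec_ratio2_V (q i) (v i) (y i))
    (\<lambda>s u v y. enc_typical n L1 L2 \<eta> q s u v \<and> dec_typical1 n M1 L1 \<eta> q u y)
    (\<lambda>s u v x y. enc_typical n L1 L2 \<eta> q s u v \<and> dec_typical2 n M2 L2 \<eta> q v x y)
    M1 M2 L1 L2 \<eta>"
proof (unfold_locales, goal_cases)
  case (16 s u)
  show ?case by (subst expect_Pi_prod) (auto intro!: prod_mono expect_enc_ratio_U expect_nonneg ratio_nonneg)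
next
  case (17 s v)
  show ?case by (subst expect_Pi_prod) (auto intro!: prod_mono expect_enc_ratio_V expect_nonneg ratio_nonneg)
next
  case (18 s)
  show ?case
    by (subst expect_Pi_prod, simp, simp, simp add: ratio_nonneg, subst expect_Pi_prod)
       (auto intro!: prod_le_1 expect_enc_ratio expect_nonneg ratio_nonneg)
next
  case (19 y)
  show ?case by (subst expect_Pi_prod) (auto intro!: prod_le_1 expect_dec_ratio1 expect_nonneg ratio_nonneg)
next
  case (20 v y)
  show ?case by (subst expect_Pi_prod) (auto intro!: prod_mono expect_dec_ratio2_V expect_nonneg ratio_nonneg)
next
  case (21 y)
  show ?case
    by (subst expect_Pi_prod, simp, simp, simp add: ratio_nonneg, subst expect_Pi_prod)
       (auto intro!: prod_le_1 expect_dec_ratio2 expect_nonneg ratio_nonneg)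
qed (use assms in \<open>auto simp: enc_typical_def dec_typical1_def dec_typical2_def intro!: prod_nonneg ratio_nonneg\<close>)

text \<open>The typical-set probabilities are averages over the time-sharing sequence. One sequence
  at least as good as the average is fixed and the one-shot code is built for it;
  \<open>5 * \<eta> \<le> 1\<close> keeps the factor in front of the probabilities
  nonnegative.\<close>

lemma exists_block_code:
  assumes pos: "0 < M1" "0 < M2" "0 < L1" "0 < L2" "0 < \<eta>" and \<eta>: "5 * \<eta> \<le> 1"
  shows "\<exists>F1 F2 g1 g2. (\<forall>y. g1 y \<in> {1..M1}) \<and> (\<forall>y. g2 y \<in> {1..M2}) \<and>
     expect (pmf_of_set {1..M1}) (\<lambda>m1. expect (Pi_pmf {1..n} undefined (\<lambda>_. pS)) (\<lambda>s.
       expect (Pi_pmf {1..n} undefined (\<lambda>i. W1 (F1 m1 s i) (s i))) (\<lambda>y. of_bool (g1 y \<noteq> m1)))) +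
     expect (pmf_of_set {1..M1}) (\<lambda>m1. expect (pmf_of_set {1..M2}) (\<lambda>m2.
       expect (Pi_pmf {1..n} undefined (\<lambda>_. pS)) (\<lambda>s.
       expect (Pi_pmf {1..n} undefined (\<lambda>i. W2 (F1 m1 s i) (F2 m2 i) (s i))) (\<lambda>y. of_bool (g2 y \<noteq> m2)))))
     \<le> 2 * (2 - (1 - 5 * \<eta>) *
       (measure_pmf.prob (Pi_pmf {1..n} undefined (\<lambda>_. P)) {\<omega>. typical1 n M1 L1 L2 \<eta> \<omega>} +
        measure_pmf.prob (Pi_pmf {1..n} undefined (\<lambda>_. P)) {\<omega>. typical2 n M2 L1 L2 \<eta> \<omega>}))"
proof -
  define H1 where "H1 q = expect (Pi_pmf {1..n} undefined (\<lambda>_. pS)) (\<lambda>s.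
    expect (Pi_pmf {1..n} undefined (\<lambda>i. pU (q i))) (\<lambda>u. expect (Pi_pmf {1..n} undefined (\<lambda>i. pV (q i))) (\<lambda>v.
    (\<Prod>i=1..n. enc_ratio (q i) (s i) (u i) (v i)) *
    expect (Pi_pmf {1..n} undefined (\<lambda>i. pX1 (u i) (v i) (s i) (q i))) (\<lambda>x1.
    expect (Pi_pmf {1..n} undefined (\<lambda>i. W1 (x1 i) (s i))) (\<lambda>y.
    of_bool (enc_typical n L1 L2 \<eta> q s u v \<and> dec_typical1 n M1 L1 \<eta> q u y))))))" for q
  define H2 where "H2 q = expect (Pi_pmf {1..n} undefined (\<lambda>_. pS)) (\<lambda>s.
    expect (Pi_pmf {1..n} undefined (\<lambda>i. pU (q i))) (\<lambda>u. expect (Pi_pmf {1..n} undefined (\<lambda>i. pV (q i))) (\<lambda>v.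
    expect (Pi_pmf {1..n} undefined (\<lambda>i. pX2 (q i))) (\<lambda>x. (\<Prod>i=1..n. enc_ratio (q i) (s i) (u i) (v i)) *
    expect (Pi_pmf {1..n} undefined (\<lambda>i. pX1 (u i) (v i) (s i) (q i))) (\<lambda>x1.
    expect (Pi_pmf {1..n} undefined (\<lambda>i. W2 (x1 i) (x i) (s i))) (\<lambda>y.
    of_bool (enc_typical n L1 L2 \<eta> q s u v \<and> dec_typical2 n M2 L2 \<eta> q v x y)))))))" for q
  \<comment> \<open>The event for receiver 1 involves neither \<open>x2\<close> nor
    \<open>y2\<close>, so these expectations disappear.\<close>
  have 1: "measure_pmf.prob (Pi_pmf {1..n} undefined (\<lambda>_. P)) {\<omega>. typical1 n M1 L1 L2 \<eta> \<omega>} =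
      expect (Pi_pmf {1..n} undefined (\<lambda>_. pQ)) H1"
    unfolding H1_def
    by (simp add: expect_prob expect_Pi_P_nested typical1_def enc_typical_def dec_typical1_def del: One_nat_def cong: prod.cong_simp)
  have 2: "measure_pmf.prob (Pi_pmf {1..n} undefined (\<lambda>_. P)) {\<omega>. typical2 n M2 L1 L2 \<eta> \<omega>} =
      expect (Pi_pmf {1..n} undefined (\<lambda>_. pQ)) H2"
    unfolding H2_def
    by (simp add: expect_prob expect_Pi_P_nested typical2_def enc_typical_def dec_typical2_def del: One_nat_def cong: prod.cong_simp)
  obtain q where q: "expect (Pi_pmf {1..n} undefined (\<lambda>_. pQ)) (\<lambda>q. H1 q + H2 q) \<le> H1 q + H2 q"
    using expect_le_point[of "Pi_pmf {1..n} undefined (\<lambda>_. pQ)" "\<lambda>q. H1 q + H2 q"] by auto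
  interpret block: one_shot "Pi_pmf {1..n} undefined (\<lambda>_. pS)" "Pi_pmf {1..n} undefined (\<lambda>i. pU (q i))"
    "Pi_pmf {1..n} undefined (\<lambda>i. pV (q i))" "Pi_pmf {1..n} undefined (\<lambda>i. pX2 (q i))"
    "\<lambda>u v s. Pi_pmf {1..n} undefined (\<lambda>i. pX1 (u i) (v i) (s i) (q i))"
    "\<lambda>x1 s. Pi_pmf {1..n} undefined (\<lambda>i. W1 (x1 i) (s i))"
    "\<lambda>x1 x2 s. Pi_pmf {1..n} undefined (\<lambda>i. W2 (x1 i) (x2 i) (s i))"
    "\<lambda>s u v. \<Prod>i=1..n. enc_ratio (q i) (s i) (u i) (v i)"
    "\<lambda>s u. \<Prod>i=1..n. enc_ratio_U (q i) (s i) (u i)"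
    "\<lambda>s v. \<Prod>i=1..n. enc_ratio_V (q i) (s i) (v i)"
    "\<lambda>u y. \<Prod>i=1..n. dec_ratio1 (q i) (u i) (y i)"
    "\<lambda>v x y. \<Prod>i=1..n. dec_ratio2 (q i) (v i) (x i) (y i)"
    "\<lambda>v y. \<Prod>i=1..n. dec_ratio2_V (q i) (v i) (y i)"
    "\<lambda>s u v y. enc_typical n L1 L2 \<eta> q s u v \<and> dec_typical1 n M1 L1 \<eta> q u y"
    "\<lambda>s u v x y. enc_typical n L1 L2 \<eta> q s u v \<and> dec_typical2 n M2 L2 \<eta> q v x y"
    M1 M2 L1 L2 \<eta>
    by (rule one_shot_block) (use pos in auto)
  let ?p = "measure_pmf.prob (Pi_pmf {1..n} undefined (\<lambda>_. P)) {\<omega>. typical1 n M1 L1 L2 \<eta> \<omega>} +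
        measure_pmf.prob (Pi_pmf {1..n} undefined (\<lambda>_. P)) {\<omega>. typical2 n M2 L1 L2 \<eta> \<omega>}"
  have "(1 - 5 * \<eta>) * ?p \<le> (1 - 5 * \<eta>) * (H1 q + H2 q)"
    using q \<eta> unfolding 1 2 expect_add by (intro mult_left_mono) auto
  hence "2 * (2 - (1 - 5 * \<eta>) * (H1 q + H2 q)) \<le> 2 * (2 - (1 - 5 * \<eta>) * ?p)" by simp
  with block.exists_code show ?thesis
    unfolding block.G1_def block.G2_def block.\<Psi>1_def block.\<Psi>2_def H1_def[symmetric] H2_def[symmetric] by (blast intro: order_trans)
qed

end

text \<open>Both error probabilities are nonnegative, so a bound on their sum bounds each. Neither
  decoding event involves the other receiver's output, which integrates out.\<close>

lemma is_codeI:
  fixes pS :: "('s::finite) pmf" and W1 :: "('x1::finite) \<Rightarrow> 's \<Rightarrow> ('y1::finite) pmf"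
    and W2 :: "'x1 \<Rightarrow> ('x2::finite) \<Rightarrow> 's \<Rightarrow> ('y2::finite) pmf"
  defines "M n R \<equiv> nat \<lceil>2 powr (real n * R)\<rceil>"
  assumes range: "\<And>y. g1 y \<in> {1..M n R1}" "\<And>y. g2 y \<in> {1..M n R2}"
    and err: "expect (pmf_of_set {1..M n R1}) (\<lambda>m1. expect (Pi_pmf {1..n} undefined (\<lambda>_. pS)) (\<lambda>s.
       expect (Pi_pmf {1..n} undefined (\<lambda>i. W1 (F1 m1 s i) (s i))) (\<lambda>y. of_bool (g1 y \<noteq> m1)))) +
     expect (pmf_of_set {1..M n R1}) (\<lambda>m1. expect (pmf_of_set {1..M n R2}) (\<lambda>m2.
       expect (Pi_pmf {1..n} undefined (\<lambda>_. pS)) (\<lambda>s.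
       expect (Pi_pmf {1..n} undefined (\<lambda>i. W2 (F1 m1 s i) (F2 m2 i) (s i))) (\<lambda>y. of_bool (g2 y \<noteq> m2))))) \<le> \<epsilon>"
  shows "is_code pS W1 W2 n R1 R2 \<epsilon> (\<lambda>i m1 s. F1 m1 s i) (\<lambda>i m2. F2 m2 i) g1 g2"
proof -
  let ?e1 = "expect (pmf_of_set {1..M n R1}) (\<lambda>m1. expect (Pi_pmf {1..n} undefined (\<lambda>_. pS)) (\<lambda>s.
       expect (Pi_pmf {1..n} undefined (\<lambda>i. W1 (F1 m1 s i) (s i))) (\<lambda>y. of_bool (g1 y \<noteq> m1))))"
  let ?e2 = "expect (pmf_of_set {1..M n R1}) (\<lambda>m1. expect (pmf_of_set {1..M n R2}) (\<lambda>m2.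
       expect (Pi_pmf {1..n} undefined (\<lambda>_. pS)) (\<lambda>s.
       expect (Pi_pmf {1..n} undefined (\<lambda>i. W2 (F1 m1 s i) (F2 m2 i) (s i))) (\<lambda>y. of_bool (g2 y \<noteq> m2)))))"
  let ?T = "transmission_pmf pS W1 W2 n R1 R2 (\<lambda>i m1 s. F1 m1 s i) (\<lambda>i m2. F2 m2 i)"
  have M: "0 < M n R" for n R by (simp add: M_def)
  have ne: "{1..M n R} \<noteq> {}" for n R using M[of n R] by auto
  have msg: "messages n R = {1..M n R}" for R by (simp add: messages_def M_def)
  note [simp] = set_pmf_of_set[OF ne finite_atLeastAtMost]
  have fin: "finite (set_pmf ?T)" unfolding transmission_pmf_def msg
    by (auto simp: set_bind_pmf simp del: One_nat_def)
  have "measure_pmf.prob ?T {(m1, m2, y1, y2). g1 y1 \<noteq> m1} = ?e1"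
    unfolding expect_prob[OF fin] unfolding transmission_pmf_def msg
    by (simp add: expect_bind del: One_nat_def)
  moreover have "measure_pmf.prob ?T {(m1, m2, y1, y2). g2 y2 \<noteq> m2} = ?e2"
    unfolding expect_prob[OF fin] unfolding transmission_pmf_def msg
    by (simp add: expect_bind del: One_nat_def)
  moreover have "0 \<le> ?e1" "0 \<le> ?e2" by (auto intro!: expect_nonneg)
  ultimately show ?thesis unfolding is_code_def msg using range err by auto
qed

section \<open>Achievability\<close>

context z_channel
begin

section \<open>Concentration of the information ratios\<close>

lemma support_P:
  assumes "\<omega> \<in> set_pmf P"
  shows "rvS \<omega> \<in> set_pmf pS" "rvQ \<omega> \<in> set_pmf pQ" "rvU \<omega> \<in> set_pmf (map_pmf fst (pUV (rvS \<omega>) (rvQ \<omega>)))"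
  using assms unfolding P_def single_letter_pmf_def by (force simp: set_bind_pmf split: prod.splits)+

text \<open>Every typicality inequality bounds from above a product over the letters of one positive
  function, so each fails with probability of order \<open>1 / n\<close>; a union bound over four
  failures for receiver 1 and five for receiver 2 finishes.\<close>

lemma prob_typical_ge:
  fixes \<delta> :: real
  assumes \<delta>: "0 < \<delta>"
  obtains c where "\<And>n M1 M2 L1 L2 \<eta>. \<lbrakk>0 < n; 0 < M1; 0 < M2; 0 < L1; 0 < L2; 0 < \<eta>;
      2 powr (real n * (\<I>\<^bsub>P\<^esub>(rvU ; rvS | rvQ) + \<delta>)) \<le> \<eta> * real L1;
      2 powr (real n * (\<I>\<^bsub>P\<^esub>(rvV ; rvS | rvQ) + \<delta>)) \<le> \<eta> * real L2;
      2 powr (real n * (\<I>\<^bsub>P\<^esub>(rvU ; rvS | rvQ) + \<I>\<^bsub>P\<^esub>(rvU \<^bold>, rvS ; rvV | rvQ) + \<delta>)) \<le> \<eta> * (real L1 * real L2);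
      2 powr (real n * (- \<I>\<^bsub>P\<^esub>(rvU ; rvY1 | rvQ) + \<delta>)) \<le> \<eta> / (real M1 * real L1);
      2 powr (real n * (- \<I>\<^bsub>P\<^esub>(rvX2 ; rvY2 | rvV \<^bold>, rvQ) + \<delta>)) \<le> \<eta> / real M2;
      2 powr (real n * (- \<I>\<^bsub>P\<^esub>(rvV \<^bold>, rvX2 ; rvY2 | rvQ) + \<delta>)) \<le> \<eta> / (real M2 * real L2)\<rbrakk> \<Longrightarrow>
      2 - c / real n \<le>
        measure_pmf.prob (Pi_pmf {1..n} undefined (\<lambda>_. P)) {\<omega>. typical1 n M1 L1 L2 \<eta> \<omega>} +
        measure_pmf.prob (Pi_pmf {1..n} undefined (\<lambda>_. P)) {\<omega>. typical2 n M2 L1 L2 \<eta> \<omega>}"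
proof -
  define f1 where "f1 \<omega> = enc_ratio_U (rvQ \<omega>) (rvS \<omega>) (rvU \<omega>)" for \<omega> :: "'s \<times> 'q \<times> 'u \<times> 'v \<times> 'x1 \<times> 'x2 \<times> 'y1 \<times> 'y2"
  define f2 where "f2 \<omega> = enc_ratio_V (rvQ \<omega>) (rvS \<omega>) (rvV \<omega>)" for \<omega> :: "'s \<times> 'q \<times> 'u \<times> 'v \<times> 'x1 \<times> 'x2 \<times> 'y1 \<times> 'y2"
  define f3 where "f3 \<omega> = enc_ratio (rvQ \<omega>) (rvS \<omega>) (rvU \<omega>) (rvV \<omega>)" for \<omega> :: "'s \<times> 'q \<times> 'u \<times> 'v \<times> 'x1 \<times> 'x2 \<times> 'y1 \<times> 'y2"
  \<comment> \<open>The decoding conditions ask for large ratios; taking reciprocals makes them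
    upper bounds like the encoder's conditions, at the price of a negated mean.\<close>
  define f4 where "f4 \<omega> = 1 / dec_ratio1 (rvQ \<omega>) (rvU \<omega>) (rvY1 \<omega>)" for \<omega> :: "'s \<times> 'q \<times> 'u \<times> 'v \<times> 'x1 \<times> 'x2 \<times> 'y1 \<times> 'y2"
  define f5 where "f5 \<omega> = dec_ratio2_V (rvQ \<omega>) (rvV \<omega>) (rvY2 \<omega>) / dec_ratio2 (rvQ \<omega>) (rvV \<omega>) (rvX2 \<omega>) (rvY2 \<omega>)" for \<omega> :: "'s \<times> 'q \<times> 'u \<times> 'v \<times> 'x1 \<times> 'x2 \<times> 'y1 \<times> 'y2"
  define f6 where "f6 \<omega> = 1 / dec_ratio2 (rvQ \<omega>) (rvV \<omega>) (rvX2 \<omega>) (rvY2 \<omega>)" for \<omega> :: "'s \<times> 'q \<times> 'u \<times> 'v \<times> 'x1 \<times> 'x2 \<times> 'y1 \<times> 'y2"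
  have pos2V: "0 < dec_ratio2_V (rvQ \<omega>) (rvV \<omega>) (rvY2 \<omega>)" if "\<omega> \<in> set_pmf P" for \<omega>
    using info_ratio_pos[OF that] unfolding dec_ratio2_V_def .
  have eq1: "f1 \<omega> = info_ratio P rvU rvS rvQ (rvU \<omega>) (rvS \<omega>) (rvQ \<omega>)" if "\<omega> \<in> set_pmf P" for \<omega>
    using support_P[OF that] by (simp add: f1_def enc_ratio_U_eq)
  have eq2: "f2 \<omega> = info_ratio P rvV rvS rvQ (rvV \<omega>) (rvS \<omega>) (rvQ \<omega>)" if "\<omega> \<in> set_pmf P" for \<omega>
    using support_P[OF that] by (simp add: f2_def enc_ratio_V_eq)
  have eq3: "f3 \<omega> = f1 \<omega> * info_ratio P (rvU \<^bold>, rvS) rvV rvQ ((rvU \<^bold>, rvS) \<omega>) (rvV \<omega>) (rvQ \<omega>)" if "\<omega> \<in> set_pmf P" for \<omega>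
    using support_P[OF that] unfolding f3_def by (subst enc_ratio_eq) (simp_all add: f1_def pair_rv_def)
  have eq4: "f4 \<omega> = 1 / info_ratio P rvU rvY1 rvQ (rvU \<omega>) (rvY1 \<omega>) (rvQ \<omega>)" for \<omega>
    by (simp add: f4_def dec_ratio1_def)
  have eq5: "f5 \<omega> = 1 / info_ratio P rvX2 rvY2 (rvV \<^bold>, rvQ) (rvX2 \<omega>) (rvY2 \<omega>) ((rvV \<^bold>, rvQ) \<omega>)" if "\<omega> \<in> set_pmf P" for \<omega>
    using pos2V[OF that] unfolding f5_def dec_ratio2_eq[OF that] by (simp add: pair_rv_def)
  have eq6: "f6 \<omega> = 1 / info_ratio P (rvV \<^bold>, rvX2) rvY2 rvQ ((rvV \<^bold>, rvX2) \<omega>) (rvY2 \<omega>) (rvQ \<omega>)" for \<omega>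
    by (simp add: f6_def dec_ratio2_def pair_rv_def)
  note ipos = info_ratio_pos[of _ P]
  have pos: "0 < f1 \<omega>" "0 < f2 \<omega>" "0 < f3 \<omega>" "0 < f4 \<omega>" "0 < f5 \<omega>" "0 < f6 \<omega>" if "\<omega> \<in> set_pmf P" for \<omega>
    by (simp_all only: eq1[OF that] eq2[OF that] eq3[OF that] eq4 eq5[OF that] eq6)
       (intro mult_pos_pos divide_pos_pos zero_less_one ipos that)+
  have \<mu>1: "\<I>\<^bsub>P\<^esub>(rvU ; rvS | rvQ) = expect P (\<lambda>\<omega>. log 2 (f1 \<omega>))"
    unfolding cond_mi_eq_expect by (intro expect_cong) (simp add: eq1)
  have \<mu>2: "\<I>\<^bsub>P\<^esub>(rvV ; rvS | rvQ) = expect P (\<lambda>\<omega>. log 2 (f2 \<omega>))"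
    unfolding cond_mi_eq_expect by (intro expect_cong) (simp add: eq2)
  have \<mu>3: "\<I>\<^bsub>P\<^esub>(rvU ; rvS | rvQ) + \<I>\<^bsub>P\<^esub>(rvU \<^bold>, rvS ; rvV | rvQ) = expect P (\<lambda>\<omega>. log 2 (f3 \<omega>))"
    unfolding \<mu>1 cond_mi_eq_expect expect_add[symmetric]
    by (intro expect_cong) (simp add: eq3 eq1 log_mult_pos ipos)
  have neg: "- expect P g = expect P (\<lambda>\<omega>. - g \<omega>)" for g
    using expect_cmult[of P "-1" g] by simp
  have \<mu>4: "- \<I>\<^bsub>P\<^esub>(rvU ; rvY1 | rvQ) = expect P (\<lambda>\<omega>. log 2 (f4 \<omega>))"
    unfolding cond_mi_eq_expect neg by (intro expect_cong) (simp add: eq4 log_divide_pos ipos)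
  have \<mu>5: "- \<I>\<^bsub>P\<^esub>(rvX2 ; rvY2 | rvV \<^bold>, rvQ) = expect P (\<lambda>\<omega>. log 2 (f5 \<omega>))"
    unfolding cond_mi_eq_expect neg by (intro expect_cong) (simp add: eq5 log_divide_pos ipos)
  have \<mu>6: "- \<I>\<^bsub>P\<^esub>(rvV \<^bold>, rvX2 ; rvY2 | rvQ) = expect P (\<lambda>\<omega>. log 2 (f6 \<omega>))"
    unfolding cond_mi_eq_expect neg by (intro expect_cong) (simp add: eq6 log_divide_pos ipos)
  let ?Pn = "\<lambda>n. Pi_pmf {1..n} undefined (\<lambda>_. P)"
  let ?bad = "\<lambda>n f B. {\<omega>. \<not> (\<Prod>i=1..n. f (\<omega> i)) \<le> B}"
  obtain c1 where c1: "\<And>n B. 0 < n \<Longrightarrow> 2 powr (real n * (\<I>\<^bsub>P\<^esub>(rvU ; rvS | rvQ) + \<delta>)) \<le> B \<Longrightarrow>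
      measure_pmf.prob (?Pn n) (?bad n f1 B) \<le> c1 / n"
    using prob_Pi_prod_le[OF pos(1) \<delta> \<mu>1, where d=undefined] by auto
  obtain c2 where c2: "\<And>n B. 0 < n \<Longrightarrow> 2 powr (real n * (\<I>\<^bsub>P\<^esub>(rvV ; rvS | rvQ) + \<delta>)) \<le> B \<Longrightarrow>
      measure_pmf.prob (?Pn n) (?bad n f2 B) \<le> c2 / n"
    using prob_Pi_prod_le[OF pos(2) \<delta> \<mu>2, where d=undefined] by auto
  obtain c3 where c3: "\<And>n B. 0 < n \<Longrightarrow> 2 powr (real n * (\<I>\<^bsub>P\<^esub>(rvU ; rvS | rvQ) + \<I>\<^bsub>P\<^esub>(rvU \<^bold>, rvS ; rvV | rvQ) + \<delta>)) \<le> B \<Longrightarrow>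
      measure_pmf.prob (?Pn n) (?bad n f3 B) \<le> c3 / n"
    using prob_Pi_prod_le[OF pos(3) \<delta> \<mu>3, where d=undefined] by auto
  obtain c4 where c4: "\<And>n B. 0 < n \<Longrightarrow> 2 powr (real n * (- \<I>\<^bsub>P\<^esub>(rvU ; rvY1 | rvQ) + \<delta>)) \<le> B \<Longrightarrow>
      measure_pmf.prob (?Pn n) (?bad n f4 B) \<le> c4 / n"
    using prob_Pi_prod_le[OF pos(4) \<delta> \<mu>4, where d=undefined] by auto
  obtain c5 where c5: "\<And>n B. 0 < n \<Longrightarrow> 2 powr (real n * (- \<I>\<^bsub>P\<^esub>(rvX2 ; rvY2 | rvV \<^bold>, rvQ) + \<delta>)) \<le> B \<Longrightarrow>
      measure_pmf.prob (?Pn n) (?bad n f5 B) \<le> c5 / n"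
    using prob_Pi_prod_le[OF pos(5) \<delta> \<mu>5, where d=undefined] by auto
  obtain c6 where c6: "\<And>n B. 0 < n \<Longrightarrow> 2 powr (real n * (- \<I>\<^bsub>P\<^esub>(rvV \<^bold>, rvX2 ; rvY2 | rvQ) + \<delta>)) \<le> B \<Longrightarrow>
      measure_pmf.prob (?Pn n) (?bad n f6 B) \<le> c6 / n"
    using prob_Pi_prod_le[OF pos(6) \<delta> \<mu>6, where d=undefined] by auto
  show ?thesis
  \<comment> \<open>The encoder's constants \<open>c1\<close>, \<open>c2\<close>, \<open>c3\<close>
    occur twice, once for each receiver.\<close>
  proof (rule that[of "c1 + c2 + c3 + c4 + (c1 + c2 + c3 + c5 + c6)"], goal_cases)
    case (1 n M1 M2 L1 L2 \<eta>)
    let ?p = "measure_pmf.prob (?Pn n)"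
    let ?B1 = "?bad n f1 (\<eta> * real L1)" and ?B2 = "?bad n f2 (\<eta> * real L2)"
      and ?B3 = "?bad n f3 (\<eta> * (real L1 * real L2))" and ?B4 = "?bad n f4 (\<eta> / (real M1 * real L1))"
      and ?B5 = "?bad n f5 (\<eta> / real M2)" and ?B6 = "?bad n f6 (\<eta> / (real M2 * real L2))"
    have sup: "\<omega> i \<in> set_pmf P" if "\<omega> \<in> set_pmf (?Pn n)" "i \<in> {1..n}" for \<omega> i
      using that by (auto simp: set_Pi_pmf PiE_dflt_def)
    \<comment> \<open>Positivity of the products allows the bounds on reciprocals to be multiplied
      out into the typicality inequalities.\<close>
    have d1: "0 < (\<Prod>i=1..n. dec_ratio1 (rvQ (\<omega> i)) (rvU (\<omega> i)) (rvY1 (\<omega> i)))" if "\<omega> \<in> set_pmf (?Pn n)" for \<omega>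
      using sup[OF that] pos(4) by (intro prod_pos) (simp add: f4_def)
    have d2: "0 < (\<Prod>i=1..n. dec_ratio2 (rvQ (\<omega> i)) (rvV (\<omega> i)) (rvX2 (\<omega> i)) (rvY2 (\<omega> i)))" if "\<omega> \<in> set_pmf (?Pn n)" for \<omega>
      using sup[OF that] pos(6) by (intro prod_pos) (simp add: f6_def)
    have compl: "?p {\<omega>. T \<omega>} = 1 - ?p {\<omega>. \<not> T \<omega>}" for T
      using measure_pmf.prob_neg[of "?Pn n" T] by simp
    have "?p {\<omega>. \<not> typical1 n M1 L1 L2 \<eta> \<omega>} \<le> ?p (?B1 \<union> ?B2 \<union> ?B3 \<union> ?B4)"
    proof (intro measure_pmf.finite_measure_mono_AE AE_pmfI impI)
      fix \<omega> assume "\<omega> \<in> set_pmf (?Pn n)" "\<omega> \<in> {\<omega>. \<not> typical1 n M1 L1 L2 \<eta> \<omega>}"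
      thus "\<omega> \<in> ?B1 \<union> ?B2 \<union> ?B3 \<union> ?B4"
        using d1[of \<omega>] 1 by (auto simp: typical1_def enc_typical_def dec_typical1_def f1_def f2_def f3_def f4_def
          prod_dividef field_simps)
    qed auto
    also have "\<dots> \<le> ?p ?B1 + ?p ?B2 + ?p ?B3 + ?p ?B4"
      by (intro order_trans[OF measure_Un_le] add_mono) auto
    also have "\<dots> \<le> c1 / n + c2 / n + c3 / n + c4 / n"
      using 1 by (intro add_mono c1 c2 c3 c4) auto
    finally have t1: "?p {\<omega>. \<not> typical1 n M1 L1 L2 \<eta> \<omega>} \<le> c1 / n + c2 / n + c3 / n + c4 / n" .
    have "?p {\<omega>. \<not> typical2 n M2 L1 L2 \<eta> \<omega>} \<le> ?p (?B1 \<union> ?B2 \<union> ?B3 \<union> ?B5 \<union> ?B6)"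
    proof (intro measure_pmf.finite_measure_mono_AE AE_pmfI impI)
      fix \<omega> assume "\<omega> \<in> set_pmf (?Pn n)" "\<omega> \<in> {\<omega>. \<not> typical2 n M2 L1 L2 \<eta> \<omega>}"
      thus "\<omega> \<in> ?B1 \<union> ?B2 \<union> ?B3 \<union> ?B5 \<union> ?B6"
        using d2[of \<omega>] 1 by (auto simp: typical2_def enc_typical_def dec_typical2_def f1_def f2_def f3_def f5_def f6_def
          prod_dividef field_simps)
    qed auto
    also have "\<dots> \<le> ?p ?B1 + ?p ?B2 + ?p ?B3 + ?p ?B5 + ?p ?B6"
      by (intro order_trans[OF measure_Un_le] add_mono) auto
    also have "\<dots> \<le> c1 / n + c2 / n + c3 / n + c5 / n + c6 / n"
      using 1 by (intro add_mono c1 c2 c3 c5 c6) auto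
    finally have t2: "?p {\<omega>. \<not> typical2 n M2 L1 L2 \<eta> \<omega>} \<le> c1 / n + c2 / n + c3 / n + c5 / n + c6 / n" .
    show ?case
      using t1 t2 unfolding compl[of "typical1 n M1 L1 L2 \<eta>"] compl[of "typical2 n M2 L1 L2 \<eta>"]
      by (simp add: add_divide_distrib)
  qed
qed

end

theorem theorem2:
  fixes pS :: "('s::finite) pmf"
    and W1 :: "('x1::finite) \<Rightarrow> 's \<Rightarrow> ('y1::finite) pmf"
    and W2 :: "'x1 \<Rightarrow> ('x2::finite) \<Rightarrow> 's \<Rightarrow> ('y2::finite) pmf"
    and pQ :: "('q::finite) pmf"
    and pUV :: "'s \<Rightarrow> 'q \<Rightarrow> (('u::finite) \<times> ('v::finite)) pmf"
    and pX1 :: "'u \<Rightarrow> 'v \<Rightarrow> 's \<Rightarrow> 'q \<Rightarrow> 'x1 pmf"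
    and pX2 :: "'q \<Rightarrow> 'x2 pmf"
    and R1 R2 :: real
  defines "P \<equiv> single_letter_pmf pS W1 W2 pQ pUV pX1 pX2"
  assumes "0 \<le> R1" and "0 \<le> R2"
    and "R1 < \<I>\<^bsub>P\<^esub>(rvU ; rvY1 | rvQ) - \<I>\<^bsub>P\<^esub>(rvU ; rvS | rvQ)"
    and "R2 < \<I>\<^bsub>P\<^esub>(rvX2 ; rvY2 | rvV \<^bold>, rvQ)"
    and "R2 < \<I>\<^bsub>P\<^esub>(rvV \<^bold>, rvX2 ; rvY2 | rvQ) - \<I>\<^bsub>P\<^esub>(rvV ; rvS | rvQ)"
    and "R1 + R2 < \<I>\<^bsub>P\<^esub>(rvU ; rvY1 | rvQ) + \<I>\<^bsub>P\<^esub>(rvV \<^bold>, rvX2 ; rvY2 | rvQ)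
           - \<I>\<^bsub>P\<^esub>(rvU ; rvS | rvQ) - \<I>\<^bsub>P\<^esub>(rvU \<^bold>, rvS ; rvV | rvQ)"
  shows "achievable pS W1 W2 R1 R2"
proof -
  interpret Z: z_channel pS W1 W2 pQ pUV pX1 pX2 .
  have P: "P = Z.P" by (simp add: P_def Z.P_def)
  define IUY where "IUY = \<I>\<^bsub>P\<^esub>(rvU ; rvY1 | rvQ)"
  define IUS where "IUS = \<I>\<^bsub>P\<^esub>(rvU ; rvS | rvQ)"
  define IVS where "IVS = \<I>\<^bsub>P\<^esub>(rvV ; rvS | rvQ)"
  define IUSV where "IUSV = \<I>\<^bsub>P\<^esub>(rvU \<^bold>, rvS ; rvV | rvQ)"
  define IXY where "IXY = \<I>\<^bsub>P\<^esub>(rvX2 ; rvY2 | rvV \<^bold>, rvQ)"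
  define IVXY where "IVXY = \<I>\<^bsub>P\<^esub>(rvV \<^bold>, rvX2 ; rvY2 | rvQ)"
  note I_defs = IUY_def IUS_def IVS_def IUSV_def IXY_def IVXY_def
  \<comment> \<open>The sixth is dictated by the sum-rate condition: \<open>2 * \<delta>\<close> is
    given up in each of \<open>T1\<close> and \<open>T2\<close>, one \<open>\<delta>\<close> goes to
    concentration and one to the decay of \<open>\<eta>\<close>.\<close>
  define \<delta> where "\<delta> = Min {IUY - IUS - R1, IXY - R2, IVXY - IVS - R2, IUY + IVXY - IUS - IUSV - R1 - R2} / 6"
  have \<delta>: "0 < \<delta>" and gaps: "6 * \<delta> \<le> IUY - IUS - R1" "6 * \<delta> \<le> IXY - R2" "6 * \<delta> \<le> IVXY - IVS - R2"
     "6 * \<delta> \<le> IUY + IVXY - IUS - IUSV - R1 - R2"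
    using assms unfolding \<delta>_def I_defs by auto
  have nonneg: "0 \<le> IUS" "0 \<le> IVS" unfolding I_defs by (intro cond_mi_nonneg)+
  \<comment> \<open>The largest auxiliary rates that decoding permits: the
    \<open>2 * \<delta>\<close> exactly pays for concentration and for \<open>\<eta>\<close>. The
    encoder's conditions then become the hypotheses on \<open>R1\<close>, \<open>R2\<close> and
    \<open>R1 + R2\<close>.\<close>
  define T1 T2 where T: "T1 = IUY - R1 - 2 * \<delta>" "T2 = IVXY - R2 - 2 * \<delta>"
  \<comment> \<open>The gaps give \<open>T1 \<ge> IUS + 4 * \<delta>\<close> and
    \<open>T2 \<ge> IVS + 4 * \<delta>\<close>. Nonnegative rates ensure that rounding up at most
    doubles a codebook size.\<close>
  have T_nonneg: "0 \<le> T1" "0 \<le> T2" using gaps nonneg \<delta> by (auto simp: T)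
  define M where "M n r = nat \<lceil>2 powr (real n * r)\<rceil>" for n r
  \<comment> \<open>The 4 absorbs the rounding of two codebook sizes, a factor of at most 2 each;
    the exponential makes the losses vanish.\<close>
  define \<eta> where "\<eta> n = 4 * 2 powr (- (real n * \<delta>))" for n
  have M_pos: "0 < M n r" for n r by (simp add: M_def)
  have M_lower: "2 powr (real n * r) \<le> real (M n r)" for n r by (simp add: M_def)
  have M_upper: "real (M n r) \<le> 2 * 2 powr (real n * r)" if "0 \<le> r" for n r
  proof -
    have "real (M n r) \<le> 2 powr (real n * r) + 1" unfolding M_def by (simp add: of_nat_nat) 
    also have "1 \<le> 2 powr (real n * r)" using that by (intro ge_one_powr_ge_zero) auto
    finally show ?thesis by simp
  qed
  have MM_upper: "real (M n r) * real (M n t) \<le> 4 * 2 powr (real n * (r + t))" if "0 \<le> r" "0 \<le> t" for n r t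
  proof -
    have "real (M n r) * real (M n t) \<le> (2 * 2 powr (real n * r)) * (2 * 2 powr (real n * t))"
      using that by (intro mult_mono M_upper) auto
    thus ?thesis by (simp add: powr_add distrib_left)
  qed
  obtain c where c: "\<And>n M1 M2 L1 L2 \<eta>. \<lbrakk>0 < n; 0 < M1; 0 < M2; 0 < L1; 0 < L2; 0 < \<eta>;
      2 powr (real n * (IUS + \<delta>)) \<le> \<eta> * real L1;
      2 powr (real n * (IVS + \<delta>)) \<le> \<eta> * real L2;
      2 powr (real n * (IUS + IUSV + \<delta>)) \<le> \<eta> * (real L1 * real L2);
      2 powr (real n * (- IUY + \<delta>)) \<le> \<eta> / (real M1 * real L1);
      2 powr (real n * (- IXY + \<delta>)) \<le> \<eta> / real M2;
      2 powr (real n * (- IVXY + \<delta>)) \<le> \<eta> / (real M2 * real L2)\<rbrakk> \<Longrightarrow>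
      2 - c / real n \<le>
        measure_pmf.prob (Pi_pmf {1..n} undefined (\<lambda>_. P)) {\<omega>. Z.typical1 n M1 L1 L2 \<eta> \<omega>} +
        measure_pmf.prob (Pi_pmf {1..n} undefined (\<lambda>_. P)) {\<omega>. Z.typical2 n M2 L1 L2 \<eta> \<omega>}"
    using Z.prob_typical_ge[OF \<delta>] unfolding P I_defs by blast
  have typical: "2 - c / real n \<le>
        measure_pmf.prob (Pi_pmf {1..n} undefined (\<lambda>_. P)) {\<omega>. Z.typical1 n (M n R1) (M n T1) (M n T2) (\<eta> n) \<omega>} +
        measure_pmf.prob (Pi_pmf {1..n} undefined (\<lambda>_. P)) {\<omega>. Z.typical2 n (M n R2) (M n T1) (M n T2) (\<eta> n) \<omega>}"
    if n: "0 < n" for n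
  proof (rule c[OF n M_pos M_pos M_pos M_pos])
    show "0 < \<eta> n" by (simp add: \<eta>_def)
    have low: "2 powr (real n * a) \<le> \<eta> n * x" if "2 powr (real n * r) \<le> x" "a + \<delta> \<le> r" for a x r
    proof -
      have "2 powr (real n * a) \<le> 2 powr (real n * (- \<delta> + r))"
        using that by (intro powr_mono mult_left_mono) auto
      also have "\<dots> = 2 powr (- (real n * \<delta>)) * 2 powr (real n * r)" unfolding distrib_left powr_add by simp
      also have "\<dots> \<le> \<eta> n * x" unfolding \<eta>_def using that by (intro mult_mono) auto
      finally show ?thesis .
    qed
    have upp: "2 powr (real n * a) \<le> \<eta> n / x" if "x \<le> 4 * 2 powr (real n * r)" "0 < x" "a + r + \<delta> \<le> 0" for a x r
    proof -
      have "2 powr (real n * a) * x \<le> 2 powr (real n * a) * (4 * 2 powr (real n * r))"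
        using that by (intro mult_left_mono) auto
      also have "\<dots> = 4 * 2 powr (real n * (a + r))" by (simp add: distrib_left powr_add)
      also have "\<dots> \<le> 4 * 2 powr (real n * (- \<delta>))"
        using that by (intro mult_left_mono powr_mono) auto
      also have "\<dots> = \<eta> n" by (simp add: \<eta>_def)
      finally show ?thesis using that by (simp add: field_simps)
    qed
    show "2 powr (real n * (IUS + \<delta>)) \<le> \<eta> n * real (M n T1)"
      using gaps \<delta> by (intro low[OF M_lower]) (auto simp: T)
    show "2 powr (real n * (IVS + \<delta>)) \<le> \<eta> n * real (M n T2)"
      using gaps \<delta> by (intro low[OF M_lower]) (auto simp: T)
    have "2 powr (real n * (T1 + T2)) \<le> real (M n T1) * real (M n T2)"
      unfolding distrib_left powr_add by (intro mult_mono M_lower) auto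
    thus "2 powr (real n * (IUS + IUSV + \<delta>)) \<le> \<eta> n * (real (M n T1) * real (M n T2))"
      using gaps \<delta> by (intro low) (auto simp: T)
    show "2 powr (real n * (- IUY + \<delta>)) \<le> \<eta> n / (real (M n R1) * real (M n T1))"
      using M_pos assms(2) T_nonneg by (intro upp[OF MM_upper]) (auto simp: T)
    show "2 powr (real n * (- IVXY + \<delta>)) \<le> \<eta> n / (real (M n R2) * real (M n T2))"
      using M_pos assms(3) T_nonneg by (intro upp[OF MM_upper]) (auto simp: T)
    \<comment> \<open>A single size needs only the factor 2; it is weakened to 4 to fit
      \<open>upp\<close>.\<close>
    have "real (M n R2) \<le> 4 * 2 powr (real n * R2)"
      using M_upper[OF assms(3), of n] by (smt (verit) powr_ge_zero)
    thus "2 powr (real n * (- IXY + \<delta>)) \<le> \<eta> n / real (M n R2)"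
      using gaps \<delta> M_pos by (intro upp) auto
  qed
  show ?thesis unfolding achievable_def
  proof (intro allI impI)
    fix \<epsilon> :: real assume \<epsilon>: "0 < \<epsilon>"
    \<comment> \<open>Both \<open>\<eta> n\<close> and \<open>c / n\<close> tend to 0, so the
      product tends to 2, the total success probability of two perfect receivers.\<close>
    have "(\<lambda>n. 2 * (2 - (1 - 5 * \<eta> n) * (2 - c / real n))) \<longlonglongrightarrow> 0"
      unfolding \<eta>_def using \<delta> by real_asymp
    hence ev: "\<forall>\<^sub>F n in sequentially. 2 * (2 - (1 - 5 * \<eta> n) * (2 - c / real n)) < \<epsilon>"
      using \<epsilon> by (rule order_tendstoD)
    have "\<eta> \<longlonglongrightarrow> 0" unfolding \<eta>_def using \<delta> by real_asymp
    hence ev2: "\<forall>\<^sub>F n in sequentially. \<eta> n < 1 / 5" by (rule order_tendstoD) simp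
    show "\<forall>\<^sub>F n in sequentially. \<exists>f1 f2 g1 g2. is_code pS W1 W2 n R1 R2 \<epsilon> f1 f2 g1 g2"
      using ev ev2 eventually_gt_at_top[of 0]
    proof eventually_elim
      case (elim n)
      have \<eta>n: "0 < \<eta> n" "5 * \<eta> n \<le> 1" using elim by (auto simp: \<eta>_def)
      let ?p = "measure_pmf.prob (Pi_pmf {1..n} undefined (\<lambda>_. P)) {\<omega>. Z.typical1 n (M n R1) (M n T1) (M n T2) (\<eta> n) \<omega>} +
        measure_pmf.prob (Pi_pmf {1..n} undefined (\<lambda>_. P)) {\<omega>. Z.typical2 n (M n R2) (M n T1) (M n T2) (\<eta> n) \<omega>}"
      have "(1 - 5 * \<eta> n) * (2 - c / real n) \<le> (1 - 5 * \<eta> n) * ?p"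
        using typical[OF elim(3)] \<eta>n by (intro mult_left_mono) auto
      moreover have "2 * (2 - b) \<le> \<epsilon>" if "a \<le> b" "2 * (2 - a) < \<epsilon>" for a b using that by argo
      ultimately have "2 * (2 - (1 - 5 * \<eta> n) * ?p) \<le> \<epsilon>" using elim(1) by blast
      with Z.exists_block_code[OF M_pos[of n R1] M_pos[of n R2] M_pos[of n T1] M_pos[of n T2] \<eta>n, of n]
      obtain F1 F2 g1 g2 where g: "\<And>y. g1 y \<in> {1..M n R1}" "\<And>y. g2 y \<in> {1..M n R2}"
        and err: "expect (pmf_of_set {1..M n R1}) (\<lambda>m1. expect (Pi_pmf {1..n} undefined (\<lambda>_. pS)) (\<lambda>s.
       expect (Pi_pmf {1..n} undefined (\<lambda>i. W1 (F1 m1 s i) (s i))) (\<lambda>y. of_bool (g1 y \<noteq> m1)))) +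
     expect (pmf_of_set {1..M n R1}) (\<lambda>m1. expect (pmf_of_set {1..M n R2}) (\<lambda>m2.
       expect (Pi_pmf {1..n} undefined (\<lambda>_. pS)) (\<lambda>s.
       expect (Pi_pmf {1..n} undefined (\<lambda>i. W2 (F1 m1 s i) (F2 m2 i) (s i))) (\<lambda>y. of_bool (g2 y \<noteq> m2))))) \<le> \<epsilon>"
        unfolding P by (meson order_trans)
      show ?case
        using is_codeI[OF g[unfolded M_def] err[unfolded M_def]] by blast
    qed
  qed
qed

end
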